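(* Let $(M,\phi,\xi,\eta,g)$ be a $(2n+1)$-dimensional Kenmotsu manifold with a generalized symmetric metric connection $\bar\nabla$ of type $(\alpha,\beta)$, with Ricci tensor $\bar S$ and $W_2$-curvature tensor $\bar W_2$, satisfying $\bar S\cdot\bar W_2(\xi,X)=0$, and let $(g,\xi,\lambda)$ be a Ricci soliton on $M$ (with respect to $\bar\nabla$). Then: (i) $-(\alpha+1)(2\lambda+\alpha+1)+\dfrac{(\lambda+\alpha+1)^2+\lambda^2}{2n}=0$ and $\beta(\alpha+1)(2\lambda+\alpha+1)=0$. (ii) If $\alpha=-1$ or $\alpha=-2\lambda-1$, then the Ricci soliton is steady.
   Context: An almost contact metric manifold is a smooth manifold $M$ of odd dimension with a $(1,1)$-tensor field $\phi$, a vector field $\xi$, a 1-form $\eta$ and a Riemannian metric $g$ such that $\phi\xi=0$, $\eta(\phi X)=0$, $\eta(\xi)=1$, $\phi^2X=-X+\eta(X)\xi$, $g(\phi X,\phi Y)=g(X,Y)-\eta(X)\eta(Y)$, $g(X,\xi)=\eta(X)$. It is a Kenmotsu manifold if, with $\nabla$ the Levi-Civita connection, $(\nabla_X\phi)Y=g(\phi X,Y)\xi-\eta(Y)\phi X$ and $\nabla_X\xi=X-\eta(X)\xi$. For smooth functions $\alpha,\beta$ on $M$, the generalized symmetric metric connection of type $(\alpha,\beta)$ is the linear connection $\bar\nabla$ with $\bar\nabla g=0$ and torsion $T(X,Y)=\alpha\{\eta(Y)X-\eta(X)Y\}+\beta\{\eta(Y)\phi X-\eta(X)\phi Y\}$;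 explicitly $\bar\nabla_XY=\nabla_XY+\alpha\{\eta(Y)X-g(X,Y)\xi\}-\beta\eta(X)\phi Y$. Its curvature tensor is $\bar R(X,Y)Z=\bar\nabla_X\bar\nabla_YZ-\bar\nabla_Y\bar\nabla_XZ-\bar\nabla_{[X,Y]}Z$, its Ricci tensor is $\bar S(Y,Z)=\operatorname{trace}(X\mapsto\bar R(X,Y)Z)$, and its Ricci operator $\bar Q$ is defined by $g(\bar QX,Y)=\bar S(X,Y)$. The $W_2$-curvature tensor of $\bar\nabla$ is $\bar W_2(X,Y)Z=\bar R(X,Y)Z+\frac{1}{\dim M-1}\bigl[g(X,Z)\bar QY-g(Y,Z)\bar QX\bigr]$. For real constants $\lambda,\mu$, the data $(g,\xi,\lambda,\mu)$ is an $\eta$-Ricci soliton on $M$ if $\mathcal L_\xi g+2\bar S+2\lambda g+2\mu\,\eta\otimes\eta=0$, where $\mathcal L_\xi g$ is written in terms of $\bar\nabla$, i.e. $2\bar S(X,Y)=-g(\bar\nabla_X\xi,Y)-g(X,\bar\nabla_Y\xi)-2\lambda g(X,Y)-2\mu\eta(X)\eta(Y)$ for all vector fields $X,Y$. If $\mu=0$, $(g,\xi,\lambda)$ is called a Ricci soliton; it is shrinking, steady or expanding according as $\lambda<0$, $\lambda=0$ or $\lambda>0$. The condition $\bar S\cdot\bar W_2(\xi,X)=0$ means that for all vector fields $X,Y,Z,V$ on $M$ $$\bar S(X,\bar W_2(Y,Z)V)\xi-\bar S(\xi,\bar W_2(Y,Z)V)X+\bar S(X,Y)\bar W_2(\xi,Z)V-\bar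 S(\xi,Y)\bar W_2(X,Z)V$$ $$+\bar S(X,Z)\bar W_2(Y,\xi)V-\bar S(\xi,Z)\bar W_2(Y,X)V+\bar S(X,V)\bar W_2(Y,Z)\xi-\bar S(\xi,V)\bar W_2(Y,Z)X=0.$$ *)

theory Defs
  imports "HOL-Analysis.Analysis" "HOL-Library.Function_Algebras"
begin

section \<open>Smooth manifolds\<close>

text \<open>\<open>C\<^sup>k\<close> maps on an open set \<open>U\<close>, by recursion over directional derivatives.\<close>

fun Ck_on :: "nat \<Rightarrow> ('b::real_normed_vector \<Rightarrow> 'c::real_normed_vector) \<Rightarrow> 'b set \<Rightarrow> bool" where
  "Ck_on 0 f U \<longleftrightarrow> continuous_on U f"
| "Ck_on (Suc k) f U \<longleftrightarrow>
     f differentiable_on U \<and> (\<forall>v. Ck_on k (\<lambda>x. frechet_derivative f (at x) v) U)"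

definition smooth_on :: "('b::real_normed_vector \<Rightarrow> 'c::real_normed_vector) \<Rightarrow> 'b set \<Rightarrow> bool" where
  "smooth_on f U \<longleftrightarrow> (\<forall>k. Ck_on k f U)"

text \<open>The manifold is the whole type \<open>'a\<close> (Hausdorff, second countable and, like every type,
  nonempty); its smooth structure is given by an atlas of charts \<open>(U, c)\<close> with
  \<open>c : U \<rightarrow> 'b\<close>, so the dimension is \<open>DIM('b)\<close>.  The atlas need not be maximal.
  Connectedness is not required.\<close>

type_synonym ('a, 'b) atlas = "('a set \<times> ('a \<Rightarrow> 'b)) set"

definition smooth_atlas ::
  "('a::{t2_space, second_countable_topology}, 'b::euclidean_space) atlas \<Rightarrow> bool" where
  "smooth_atlas A \<longleftrightarrow>
     (\<forall>(U, c) \<in> A. open U \<and> open (c ` U) \<and> homeomorphism U (c ` U) c (inv_into U c)) \<and>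
     (\<Union>(U, c) \<in> A. U) = UNIV \<and>
     (\<forall>(U, c) \<in> A. \<forall>(V, d) \<in> A. smooth_on (d \<circ> inv_into U c) (c ` (U \<inter> V)))"

definition smooth_fun :: "('a, 'b::euclidean_space) atlas \<Rightarrow> ('a \<Rightarrow> real) set" where
  "smooth_fun A = {f. \<forall>(U, c) \<in> A. smooth_on (f \<circ> inv_into U c) (c ` U)}"

section \<open>Tangent vectors and vector fields\<close>

text \<open>Tangent vectors at \<open>p\<close> are the derivations at \<open>p\<close> of the algebra of smooth functions.
  They are set to \<open>0\<close> on non-smooth functions, so that equality of tangent vectors is equality
  of HOL functions.  Sums and differences are the pointwise ones.\<close>

type_synonym 'a tvec = "('a \<Rightarrow> real) \<Rightarrow> real"
type_synonym 'a vfield = "'a \<Rightarrow> 'a tvec"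

definition tscale :: "real \<Rightarrow> 'a tvec \<Rightarrow> 'a tvec"  (infixr \<open>*\<^sub>t\<close> 75) where
  "c *\<^sub>t v = (\<lambda>f. c * v f)"

interpretation tvec: vector_space "tscale :: real \<Rightarrow> 'a tvec \<Rightarrow> 'a tvec"
  by unfold_locales (auto simp: tscale_def fun_eq_iff algebra_simps)

definition tangent_space :: "('a, 'b::euclidean_space) atlas \<Rightarrow> 'a \<Rightarrow> 'a tvec set" where
  "tangent_space A p = {v.
     (\<forall>f. f \<notin> smooth_fun A \<longrightarrow> v f = 0) \<and>
     (\<forall>f\<in>smooth_fun A. \<forall>h\<in>smooth_fun A. v (f + h) = v f + v h) \<and>
     (\<forall>a. \<forall>f\<in>smooth_fun A. v (\<lambda>q. a * f q) = a * v f) \<and>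
     (\<forall>f\<in>smooth_fun A. \<forall>h\<in>smooth_fun A. v (f * h) = f p * v h + h p * v f)}"

definition deriv_along :: "'a vfield \<Rightarrow> ('a \<Rightarrow> real) \<Rightarrow> ('a \<Rightarrow> real)" where
  "deriv_along X f = (\<lambda>p. X p f)"

definition vfields :: "('a, 'b::euclidean_space) atlas \<Rightarrow> 'a vfield set" where
  "vfields A = {X. (\<forall>p. X p \<in> tangent_space A p) \<and>
                   (\<forall>f\<in>smooth_fun A. deriv_along X f \<in> smooth_fun A)}"

definition fscale :: "('a \<Rightarrow> real) \<Rightarrow> 'a vfield \<Rightarrow> 'a vfield"  (infixr \<open>\<odot>\<close> 75) where
  "f \<odot> X = (\<lambda>p. f p *\<^sub>t X p)"

definition lie_bracket :: "'a vfield \<Rightarrow> 'a vfield \<Rightarrow> 'a vfield" where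
  "lie_bracket X Y = (\<lambda>p f. X p (deriv_along Y f) - Y p (deriv_along X f))"

section \<open>Tensor fields\<close>

type_synonym 'a oneform = "'a \<Rightarrow> 'a tvec \<Rightarrow> real"
type_synonym 'a endo = "'a \<Rightarrow> 'a tvec \<Rightarrow> 'a tvec"
type_synonym 'a bilin = "'a \<Rightarrow> 'a tvec \<Rightarrow> 'a tvec \<Rightarrow> real"

text \<open>Application of a tensor field to vector fields.\<close>

definition ap1 :: "('a \<Rightarrow> 'a tvec \<Rightarrow> 'c) \<Rightarrow> 'a vfield \<Rightarrow> ('a \<Rightarrow> 'c)" where
  "ap1 T X = (\<lambda>p. T p (X p))"

definition ap2 :: "'a bilin \<Rightarrow> 'a vfield \<Rightarrow> 'a vfield \<Rightarrow> ('a \<Rightarrow> real)" where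
  "ap2 T X Y = (\<lambda>p. T p (X p) (Y p))"

definition one_form :: "('a, 'b::euclidean_space) atlas \<Rightarrow> 'a oneform \<Rightarrow> bool" where
  "one_form A \<eta> \<longleftrightarrow>
     (\<forall>p. \<forall>u\<in>tangent_space A p. \<forall>v\<in>tangent_space A p. \<eta> p (u + v) = \<eta> p u + \<eta> p v) \<and>
     (\<forall>p c. \<forall>u\<in>tangent_space A p. \<eta> p (c *\<^sub>t u) = c * \<eta> p u) \<and>
     (\<forall>X\<in>vfields A. ap1 \<eta> X \<in> smooth_fun A)"

definition endo_tensor :: "('a, 'b::euclidean_space) atlas \<Rightarrow> 'a endo \<Rightarrow> bool" where
  "endo_tensor A \<phi> \<longleftrightarrow>
     (\<forall>p. \<forall>u\<in>tangent_space A p. \<phi> p u \<in> tangent_space A p) \<and>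
     (\<forall>p. \<forall>u\<in>tangent_space A p. \<forall>v\<in>tangent_space A p. \<phi> p (u + v) = \<phi> p u + \<phi> p v) \<and>
     (\<forall>p c. \<forall>u\<in>tangent_space A p. \<phi> p (c *\<^sub>t u) = c *\<^sub>t \<phi> p u) \<and>
     (\<forall>X\<in>vfields A. ap1 \<phi> X \<in> vfields A)"

definition riemannian_metric :: "('a, 'b::euclidean_space) atlas \<Rightarrow> 'a bilin \<Rightarrow> bool" where
  "riemannian_metric A g \<longleftrightarrow>
     (\<forall>p. \<forall>u\<in>tangent_space A p. \<forall>v\<in>tangent_space A p. \<forall>w\<in>tangent_space A p.
        g p (u + v) w = g p u w + g p v w) \<and>
     (\<forall>p c. \<forall>u\<in>tangent_space A p. \<forall>v\<in>tangent_space A p. g p (c *\<^sub>t u) v = c * g p u v) \<and>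
     (\<forall>p. \<forall>u\<in>tangent_space A p. \<forall>v\<in>tangent_space A p. g p u v = g p v u) \<and>
     (\<forall>p. \<forall>u\<in>tangent_space A p. u \<noteq> 0 \<longrightarrow> g p u u > 0) \<and>
     (\<forall>X\<in>vfields A. \<forall>Y\<in>vfields A. ap2 g X Y \<in> smooth_fun A)"

section \<open>Linear connections and curvature\<close>

type_synonym 'a conn = "'a vfield \<Rightarrow> 'a vfield \<Rightarrow> 'a vfield"

definition linear_connection :: "('a, 'b::euclidean_space) atlas \<Rightarrow> 'a conn \<Rightarrow> bool" where
  "linear_connection A D \<longleftrightarrow>
     (\<forall>X\<in>vfields A. \<forall>Y\<in>vfields A. D X Y \<in> vfields A) \<and>
     (\<forall>X\<in>vfields A. \<forall>Y\<in>vfields A. \<forall>Z\<in>vfields A. D (X + Y) Z = D X Z + D Y Z) \<and>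
     (\<forall>X\<in>vfields A. \<forall>Y\<in>vfields A. \<forall>Z\<in>vfields A. D X (Y + Z) = D X Y + D X Z) \<and>
     (\<forall>f\<in>smooth_fun A. \<forall>X\<in>vfields A. \<forall>Y\<in>vfields A. D (f \<odot> X) Y = f \<odot> D X Y) \<and>
     (\<forall>f\<in>smooth_fun A. \<forall>X\<in>vfields A. \<forall>Y\<in>vfields A.
        D X (f \<odot> Y) = deriv_along X f \<odot> Y + f \<odot> D X Y)"

definition torsion :: "'a conn \<Rightarrow> 'a vfield \<Rightarrow> 'a vfield \<Rightarrow> 'a vfield" where
  "torsion D X Y = D X Y - D Y X - lie_bracket X Y"

definition metric_connection :: "('a, 'b::euclidean_space) atlas \<Rightarrow> 'a bilin \<Rightarrow> 'a conn \<Rightarrow> bool" where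
  "metric_connection A g D \<longleftrightarrow> linear_connection A D \<and>
     (\<forall>X\<in>vfields A. \<forall>Y\<in>vfields A. \<forall>Z\<in>vfields A.
        deriv_along X (ap2 g Y Z) = ap2 g (D X Y) Z + ap2 g Y (D X Z))"

definition levi_civita :: "('a, 'b::euclidean_space) atlas \<Rightarrow> 'a bilin \<Rightarrow> 'a conn \<Rightarrow> bool" where
  "levi_civita A g D \<longleftrightarrow> metric_connection A g D \<and>
     (\<forall>X\<in>vfields A. \<forall>Y\<in>vfields A. torsion D X Y = 0)"

definition curvature :: "'a conn \<Rightarrow> 'a vfield \<Rightarrow> 'a vfield \<Rightarrow> 'a vfield \<Rightarrow> 'a vfield" where
  "curvature D X Y Z = D X (D Y Z) - D Y (D X Z) - D (lie_bracket X Y) Z"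

text \<open>Trace of a linear endomorphism \<open>L\<close> of a finite-dimensional space \<open>V\<close> of tangent vectors,
  computed in some (equivalently, any) basis of \<open>V\<close>.\<close>

definition lin_trace :: "'a tvec set \<Rightarrow> ('a tvec \<Rightarrow> 'a tvec) \<Rightarrow> real" where
  "lin_trace V L =
     (let B = (SOME B. tvec.independent B \<and> tvec.span B = V)
      in \<Sum>b\<in>B. tvec.representation B (L b) b)"

text \<open>The Ricci tensor at \<open>p\<close> is the trace of the endomorphism of the tangent space at \<open>p\<close>
  which sends \<open>v\<close> to the value at \<open>p\<close> of \<open>R(X,Y)Z\<close>, where \<open>X\<close> is a vector field extending \<open>v\<close>;
  by tensoriality the choice of \<open>X\<close> does not matter.\<close>

definition extend_vec :: "('a, 'b::euclidean_space) atlas \<Rightarrow> 'a \<Rightarrow> 'a tvec \<Rightarrow> 'a vfield" where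
  "extend_vec A p v = (SOME X. X \<in> vfields A \<and> X p = v)"

definition ricci ::
  "('a, 'b::euclidean_space) atlas \<Rightarrow> 'a conn \<Rightarrow> 'a vfield \<Rightarrow> 'a vfield \<Rightarrow> ('a \<Rightarrow> real)" where
  "ricci A D Y Z =
     (\<lambda>p. lin_trace (tangent_space A p) (\<lambda>v. curvature D (extend_vec A p v) Y Z p))"

definition ricci_op ::
  "('a, 'b::euclidean_space) atlas \<Rightarrow> 'a bilin \<Rightarrow> 'a conn \<Rightarrow> 'a vfield \<Rightarrow> 'a vfield" where
  "ricci_op A g D X =
     (THE W. W \<in> vfields A \<and> (\<forall>Y\<in>vfields A. ap2 g W Y = ricci A D X Y))"

definition W2_curvature ::
  "('a, 'b::euclidean_space) atlas \<Rightarrow> 'a bilin \<Rightarrow> 'a conn \<Rightarrow>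
     'a vfield \<Rightarrow> 'a vfield \<Rightarrow> 'a vfield \<Rightarrow> 'a vfield" where
  "W2_curvature A g D X Y Z = curvature D X Y Z +
     (\<lambda>_. 1 / (real DIM('b) - 1)) \<odot>
       (ap2 g X Z \<odot> ricci_op A g D Y - ap2 g Y Z \<odot> ricci_op A g D X)"

section \<open>Kenmotsu manifolds\<close>

definition almost_contact_metric ::
  "('a::{t2_space, second_countable_topology}, 'b::euclidean_space) atlas \<Rightarrow>
     'a endo \<Rightarrow> 'a vfield \<Rightarrow> 'a oneform \<Rightarrow> 'a bilin \<Rightarrow> bool" where
  "almost_contact_metric A \<phi> \<xi> \<eta> g \<longleftrightarrow>
     smooth_atlas A \<and> odd DIM('b) \<and>
     endo_tensor A \<phi> \<and> \<xi> \<in> vfields A \<and> one_form A \<eta> \<and> riemannian_metric A g \<and>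
     ap1 \<phi> \<xi> = 0 \<and> ap1 \<eta> \<xi> = 1 \<and>
     (\<forall>X\<in>vfields A. ap1 \<eta> (ap1 \<phi> X) = 0) \<and>
     (\<forall>X\<in>vfields A. ap1 \<phi> (ap1 \<phi> X) = - X + ap1 \<eta> X \<odot> \<xi>) \<and>
     (\<forall>X\<in>vfields A. \<forall>Y\<in>vfields A.
        ap2 g (ap1 \<phi> X) (ap1 \<phi> Y) = ap2 g X Y - ap1 \<eta> X * ap1 \<eta> Y) \<and>
     (\<forall>X\<in>vfields A. ap2 g X \<xi> = ap1 \<eta> X)"

definition kenmotsu ::
  "('a::{t2_space, second_countable_topology}, 'b::euclidean_space) atlas \<Rightarrow>
     'a endo \<Rightarrow> 'a vfield \<Rightarrow> 'a oneform \<Rightarrow> 'a bilin \<Rightarrow> bool" where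
  "kenmotsu A \<phi> \<xi> \<eta> g \<longleftrightarrow> almost_contact_metric A \<phi> \<xi> \<eta> g \<and>
     (\<exists>D. levi_civita A g D \<and>
        (\<forall>X\<in>vfields A. \<forall>Y\<in>vfields A.
           D X (ap1 \<phi> Y) - ap1 \<phi> (D X Y) =
             ap2 g (ap1 \<phi> X) Y \<odot> \<xi> - ap1 \<eta> Y \<odot> ap1 \<phi> X) \<and>
        (\<forall>X\<in>vfields A. D X \<xi> = X - ap1 \<eta> X \<odot> \<xi>))"

text \<open>Here \<open>D\<close> plays the role of the connection \<open>\<nabla>\<close> with bar.\<close>

definition gen_sym_metric_connection ::
  "('a, 'b::euclidean_space) atlas \<Rightarrow> 'a endo \<Rightarrow> 'a oneform \<Rightarrow> 'a bilin \<Rightarrow>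
     ('a \<Rightarrow> real) \<Rightarrow> ('a \<Rightarrow> real) \<Rightarrow> 'a conn \<Rightarrow> bool" where
  "gen_sym_metric_connection A \<phi> \<eta> g \<alpha> \<beta> D \<longleftrightarrow>
     \<alpha> \<in> smooth_fun A \<and> \<beta> \<in> smooth_fun A \<and> metric_connection A g D \<and>
     (\<forall>X\<in>vfields A. \<forall>Y\<in>vfields A. torsion D X Y =
        \<alpha> \<odot> (ap1 \<eta> Y \<odot> X - ap1 \<eta> X \<odot> Y) +
        \<beta> \<odot> (ap1 \<eta> Y \<odot> ap1 \<phi> X - ap1 \<eta> X \<odot> ap1 \<phi> Y))"

definition eta_ricci_soliton ::
  "('a, 'b::euclidean_space) atlas \<Rightarrow> 'a bilin \<Rightarrow> 'a oneform \<Rightarrow> 'a conn \<Rightarrow>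
     'a vfield \<Rightarrow> real \<Rightarrow> real \<Rightarrow> bool" where
  "eta_ricci_soliton A g \<eta> D \<xi> lam \<mu> \<longleftrightarrow>
     (\<forall>X\<in>vfields A. \<forall>Y\<in>vfields A. \<forall>p.
        2 * ricci A D X Y p =
          - ap2 g (D X \<xi>) Y p - ap2 g X (D Y \<xi>) p
          - 2 * lam * ap2 g X Y p - 2 * \<mu> * ap1 \<eta> X p * ap1 \<eta> Y p)"

definition ricci_soliton ::
  "('a, 'b::euclidean_space) atlas \<Rightarrow> 'a bilin \<Rightarrow> 'a oneform \<Rightarrow> 'a conn \<Rightarrow>
     'a vfield \<Rightarrow> real \<Rightarrow> bool" where
  "ricci_soliton A g \<eta> D \<xi> lam \<longleftrightarrow> eta_ricci_soliton A g \<eta> D \<xi> lam 0"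

definition steady_ricci_soliton ::
  "('a, 'b::euclidean_space) atlas \<Rightarrow> 'a bilin \<Rightarrow> 'a oneform \<Rightarrow> 'a conn \<Rightarrow>
     'a vfield \<Rightarrow> real \<Rightarrow> bool" where
  "steady_ricci_soliton A g \<eta> D \<xi> lam \<longleftrightarrow> ricci_soliton A g \<eta> D \<xi> lam \<and> lam = 0"

definition S_dot_W2_vanishes ::
  "('a, 'b::euclidean_space) atlas \<Rightarrow> 'a bilin \<Rightarrow> 'a conn \<Rightarrow> 'a vfield \<Rightarrow> bool" where
  "S_dot_W2_vanishes A g D \<xi> \<longleftrightarrow>
     (let S = ricci A D; W = W2_curvature A g D in
      \<forall>X\<in>vfields A. \<forall>Y\<in>vfields A. \<forall>Z\<in>vfields A. \<forall>V\<in>vfields A.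
        S X (W Y Z V) \<odot> \<xi> - S \<xi> (W Y Z V) \<odot> X
        + S X Y \<odot> W \<xi> Z V - S \<xi> Y \<odot> W X Z V
        + S X Z \<odot> W Y \<xi> V - S \<xi> Z \<odot> W Y X V
        + S X V \<odot> W Y Z \<xi> - S \<xi> V \<odot> W Y Z X = 0)"

end

(*
  Write a = alpha + 1 and k = 1/(2n).  From the torsion, D_X xi = a (X - eta(X) xi), so R(X,Y)xi is
  explicit in a, beta and da, and the soliton equation gives S and Q in terms of a and lambda.
  At each point put s = xi(a) + a.  Pairing the condition S.W2 = 0 with xi, in directions orthogonal
  to xi, gives
    a beta (2 lambda + a) = 0   and   s (2 lambda + a) = k ((lambda + a)^2 + lambda^2),
  while the trace of R(.,xi)xi compared with the soliton gives 2n s = lambda + a beta tr(phi).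
  Together these force a beta = 0, s = k lambda and a (lambda + a) = 0 everywhere.  Differentiating
  the last identity along xi yields lambda = 0 and a = 0, so the conclusions hold with alpha = -1.

  As alpha is a function, its derivatives cannot be dropped from the curvature.  The trace also needs
  that the derivations at a point form a space of dimension DIM('b), all of whose elements extend to
  vector fields; this rests on bump functions and Hadamard's lemma.
*)
theory Submission
  imports Defs
begin

section \<open>Calculus of \<open>C\<^sup>k\<close> functions\<close>

text \<open>The Ricci operator acts as -lambda on xi and as -(lambda + a) orthogonally to xi. In the
  xi-component of the condition each of these values enters once through S and once through the Q
  inside W2; this is the origin of the two squares. For non-constant alpha the condition contains s
  where (i) contains a, so (i) cannot be read off from it. The trace is brought in as a second
  determination of s, and comparing the two ties a to lambda. The trace of phi may stay an
  unspecified number: if a beta were nonzero at a point, then 2 lambda + a = 0 there, both squares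
  would vanish, and a would be 0 after all. The identity a (lambda + a) = 0 may be satisfied by
  different factors at different points. Differentiating the product, instead of arguing on each
  piece that a is constant, keeps the argument pointwise. With xi(a) = k lambda - a the two branches
  become k lambda^2 = 0 and (k + 1) lambda^2 = 0, and k > 0 settles both.\<close>

lemma Ck_on_cong:
  assumes "open U" "\<And>x. x \<in> U \<Longrightarrow> f x = g x" "Ck_on k f U"
  shows "Ck_on k g U"
  using assms(2,3)
proof (induction k arbitrary: f g)
  case 0
  then show ?case using continuous_on_cong by (metis Ck_on.simps(1))
next
  case (Suc k)
  have d: "(g has_derivative frechet_derivative f (at x)) (at x)" if "x \<in> U" for x
  proof -
    have "f differentiable (at x)"
      using Suc.prems(2) that at_within_open[OF that assms(1)] by (auto simp: differentiable_on_def)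
    then have "(f has_derivative frechet_derivative f (at x)) (at x)"
      by (simp add: frechet_derivative_works)
    then show ?thesis
      by (rule has_derivative_transform_within_open[OF _ assms(1) that]) (rule Suc.prems(1))
  qed
  have "Ck_on k (\<lambda>x. frechet_derivative g (at x) v) U" for v
  proof (rule Suc.IH)
    show "frechet_derivative f (at x) v = frechet_derivative g (at x) v" if "x \<in> U" for x
      using frechet_derivative_at[OF d[OF that]] by simp
    show "Ck_on k (\<lambda>x. frechet_derivative f (at x) v) U" using Suc.prems(2) by simp
  qed
  moreover have "g differentiable_on U"
    using d by (intro differentiable_at_imp_differentiable_on) (auto simp: differentiable_def)
  ultimately show ?case by simp
qed

text \<open>Allows a derivative to be supplied by a formula: uniqueness of derivatives on an open
  set identifies it with the one chosen by \<open>frechet_derivative\<close>.\<close>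

lemma Ck_on_SucI:
  assumes "open U" "\<And>x. x \<in> U \<Longrightarrow> (f has_derivative f' x) (at x)"
    and "\<And>v. Ck_on k (\<lambda>x. f' x v) U"
  shows "Ck_on (Suc k) f U"
proof -
  have "f' x = frechet_derivative f (at x)" if "x \<in> U" for x
    by (rule frechet_derivative_at[OF assms(2)[OF that]])
  then have "Ck_on k (\<lambda>x. frechet_derivative f (at x) v) U" for v
    by (intro Ck_on_cong[OF assms(1) _ assms(3)[of v]]) simp
  moreover have "f differentiable_on U"
    using assms(2) by (intro differentiable_at_imp_differentiable_on) (auto simp: differentiable_def)
  ultimately show ?thesis by simp
qed

lemma Ck_on_SucD:
  assumes "open U" "Ck_on (Suc k) f U"
  shows "x \<in> U \<Longrightarrow> (f has_derivative frechet_derivative f (at x)) (at x)"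
    and "Ck_on k (\<lambda>x. frechet_derivative f (at x) v) U"
proof -
  show "(f has_derivative frechet_derivative f (at x)) (at x)" if "x \<in> U"
    using assms(2) that at_within_open[OF that assms(1)]
    by (auto simp: differentiable_on_def frechet_derivative_works)
  show "Ck_on k (\<lambda>x. frechet_derivative f (at x) v) U"
    using assms(2) by simp
qed

lemma Ck_on_lower: "Ck_on (Suc k) f U \<Longrightarrow> Ck_on k f U"
proof (induction k arbitrary: f)
  case 0
  then show ?case by (simp add: differentiable_imp_continuous_on)
next
  case (Suc k)
  then show ?case by (metis Ck_on.simps(2))
qed

declare Ck_on.simps(2) [simp del]

text \<open>Serves for gluing: a function extended by zero is checked separately near its support
  and away from it.\<close>

lemma Ck_on_local:
  assumes "open U" "\<And>x. x \<in> U \<Longrightarrow> \<exists>V. open V \<and> x \<in> V \<and> Ck_on k f V"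
  shows "Ck_on k f U"
  using assms(2)
proof (induction k arbitrary: f)
  case 0
  then have "isCont f x" if "x \<in> U" for x
    using continuous_on_eq_continuous_at that by (metis Ck_on.simps(1))
  then show ?case by (simp add: continuous_at_imp_continuous_on)
next
  case (Suc k)
  show ?case
  proof (rule Ck_on_SucI[OF assms(1)])
    show "(f has_derivative frechet_derivative f (at x)) (at x)" if "x \<in> U" for x
    proof -
      obtain V where V: "open V" "x \<in> V" "Ck_on (Suc k) f V"
        using Suc.prems \<open>x \<in> U\<close> by blast
      show ?thesis by (rule Ck_on_SucD(1)[OF V(1,3,2)])
    qed
    show "Ck_on k (\<lambda>x. frechet_derivative f (at x) v) U" for v
    proof (rule Suc.IH)
      fix x assume "x \<in> U"
      then obtain V where V: "open V" "x \<in> V" "Ck_on (Suc k) f V" using Suc.prems by blast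
      show "\<exists>V. open V \<and> x \<in> V \<and> Ck_on k (\<lambda>x. frechet_derivative f (at x) v) V"
        using V(1,2) Ck_on_SucD(2)[OF V(1,3)] by auto
    qed
  qed
qed

lemma Ck_on_continuous: "Ck_on k f U \<Longrightarrow> continuous_on U f"
  by (induction k) (auto dest: Ck_on_lower)

lemma Ck_on_subset:
  assumes "open U" "open V" "V \<subseteq> U" "Ck_on k f U"
  shows "Ck_on k f V"
  using assms by (intro Ck_on_local[OF assms(2)] exI[of _ U]) auto

lemma Ck_on_const: "open U \<Longrightarrow> Ck_on k (\<lambda>x. c) U"
proof (induction k arbitrary: c)
  case (Suc k)
  show ?case
    by (rule Ck_on_SucI[where f' = "\<lambda>_ _. 0"]) (use Suc in simp_all)
qed simp

lemma Ck_on_bounded_linear: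
  assumes "open U" "bounded_linear L"
  shows "Ck_on k L U"
proof (cases k)
  case 0
  then show ?thesis using assms by (simp add: linear_continuous_on)
next
  case (Suc j)
  show ?thesis
    unfolding Suc
    by (intro Ck_on_SucI[where f' = "\<lambda>_. L"] Ck_on_const bounded_linear_imp_has_derivative assms)
qed

lemma Ck_on_bounded_linear_compose:
  assumes "open U" "bounded_linear L" "Ck_on k f U"
  shows "Ck_on k (\<lambda>x. L (f x)) U"
  using assms(3)
proof (induction k arbitrary: f)
  case 0
  then show ?case using assms(2) by (auto intro: bounded_linear.continuous_on)
next
  case (Suc k)
  show ?case
    by (rule Ck_on_SucI[OF assms(1), where f' = "\<lambda>x v. L (frechet_derivative f (at x) v)"])
      (auto intro!: Suc.IH bounded_linear.has_derivative[OF assms(2)] Ck_on_SucD[OF assms(1) Suc.prems])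
qed

lemma Ck_on_add:
  assumes "open U" "Ck_on k f U" "Ck_on k g U"
  shows "Ck_on k (\<lambda>x. f x + g x) U"
  using assms(2,3)
proof (induction k arbitrary: f g)
  case 0
  then show ?case by (auto intro: continuous_on_add)
next
  case (Suc k)
  show ?case
    by (rule Ck_on_SucI[OF assms(1), where
          f' = "\<lambda>x v. frechet_derivative f (at x) v + frechet_derivative g (at x) v"])
      (auto intro!: Suc.IH has_derivative_add Ck_on_SucD[OF assms(1) Suc.prems(1)]
        Ck_on_SucD[OF assms(1) Suc.prems(2)])
qed

lemma Ck_on_sum:
  assumes "open U" "\<And>i. i \<in> I \<Longrightarrow> Ck_on k (f i) U"
  shows "Ck_on k (\<lambda>x. \<Sum>i\<in>I. f i x) U"
  using assms(2)
  by (induction I rule: infinite_finite_induct) (auto intro: assms(1) Ck_on_const Ck_on_add)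

lemma Ck_on_mult:
  fixes f g :: "'b::real_normed_vector \<Rightarrow> real"
  assumes "open U" "Ck_on k f U" "Ck_on k g U"
  shows "Ck_on k (\<lambda>x. f x * g x) U"
  using assms(2,3)
proof (induction k arbitrary: f g)
  case 0
  then show ?case by (auto intro: continuous_on_mult)
next
  case (Suc k)
  note lower = Suc.prems[THEN Ck_on_lower]
  show ?case
    by (rule Ck_on_SucI[OF assms(1), where
          f' = "\<lambda>x v. f x * frechet_derivative g (at x) v + frechet_derivative f (at x) v * g x"])
      (auto intro!: Suc.IH lower has_derivative_mult Ck_on_add assms(1) Ck_on_SucD[OF assms(1) Suc.prems(1)]
        Ck_on_SucD[OF assms(1) Suc.prems(2)])
qed

text \<open>In the chain rule the outer derivative is taken in the moving direction
  \<open>?g' x v\<close>, whereas the induction hypothesis speaks of one function composed with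
  \<open>g\<close>. Expanding that direction in the basis leaves sums of products of fixed partial
  derivatives composed with \<open>g\<close>.\<close>

lemma Ck_on_compose:
  fixes f :: "'c::euclidean_space \<Rightarrow> real" and g :: "'b::real_normed_vector \<Rightarrow> 'c"
  assumes "open U" "open V" "g ` U \<subseteq> V" "Ck_on k f V" "Ck_on k g U"
  shows "Ck_on k (\<lambda>x. f (g x)) U"
  using assms(4,5)
proof (induction k arbitrary: f)
  case 0
  then show ?case using assms(3) continuous_on_compose2[of V f U g] by simp
next
  case (Suc k)
  let ?f' = "\<lambda>x v. frechet_derivative f (at x) v" and ?g' = "\<lambda>x v. frechet_derivative g (at x) v"
  show ?case
  proof (rule Ck_on_SucI[OF assms(1)])
    fix x assume x: "x \<in> U"
    have f: "(f has_derivative ?f' (g x)) (at (g x))"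
      using Ck_on_SucD(1)[OF assms(2) Suc.prems(1)] x assms(3) by blast
    then have lin: "linear (?f' (g x))" by (rule has_derivative_linear)
    have "((\<lambda>x. f (g x)) has_derivative (\<lambda>v. ?f' (g x) (?g' x v))) (at x)"
      using diff_chain_at[OF Ck_on_SucD(1)[OF assms(1) Suc.prems(2) x] f] by (simp add: o_def)
    moreover have "?f' (g x) (?g' x v) = (\<Sum>i\<in>Basis. (?g' x v \<bullet> i) * ?f' (g x) i)" for v
    proof -
      have "?f' (g x) (?g' x v) = ?f' (g x) (\<Sum>i\<in>Basis. (?g' x v \<bullet> i) *\<^sub>R i)"
        by (simp add: euclidean_representation)
      also have "\<dots> = (\<Sum>i\<in>Basis. (?g' x v \<bullet> i) * ?f' (g x) i)"
        by (simp only: linear_sum[OF lin] linear_cmul[OF lin] real_scaleR_def)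
      finally show ?thesis .
    qed
    ultimately show "((\<lambda>x. f (g x)) has_derivative
        (\<lambda>v. \<Sum>i\<in>Basis. (?g' x v \<bullet> i) * ?f' (g x) i)) (at x)" by simp
  next
    show "Ck_on k (\<lambda>x. \<Sum>i\<in>Basis. (?g' x v \<bullet> i) * ?f' (g x) i) U" for v
    proof (intro Ck_on_sum Ck_on_mult assms(1) Suc.IH)
      show "Ck_on k (\<lambda>x. ?g' x v \<bullet> i) U" for i
        by (rule Ck_on_bounded_linear_compose[OF assms(1) bounded_linear_inner_left])
          (rule Ck_on_SucD(2)[OF assms(1) Suc.prems(2)])
      show "Ck_on k (\<lambda>y. ?f' y i) V" for i
        by (rule Ck_on_SucD(2)[OF assms(2) Suc.prems(1)])
      show "Ck_on k g U" by (rule Ck_on_lower) (rule Suc.prems(2))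
    qed
  qed
qed

section \<open>Infinitely differentiable maps\<close>

lemma smooth_on_cong: "open U \<Longrightarrow> (\<And>x. x \<in> U \<Longrightarrow> f x = g x) \<Longrightarrow> smooth_on f U \<Longrightarrow> smooth_on g U"
  unfolding smooth_on_def using Ck_on_cong by blast

lemma smooth_on_local:
  assumes "open U" "\<And>x. x \<in> U \<Longrightarrow> \<exists>V. open V \<and> x \<in> V \<and> smooth_on f V"
  shows "smooth_on f U"
  unfolding smooth_on_def
proof
  show "Ck_on k f U" for k
    by (rule Ck_on_local[OF assms(1)]) (use assms(2) in \<open>unfold smooth_on_def, blast\<close>)
qed

lemma smooth_on_subset: "open U \<Longrightarrow> open V \<Longrightarrow> V \<subseteq> U \<Longrightarrow> smooth_on f U \<Longrightarrow> smooth_on f V"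
  unfolding smooth_on_def using Ck_on_subset by blast

lemma smooth_on_const: "open U \<Longrightarrow> smooth_on (\<lambda>x. c) U"
  by (simp add: smooth_on_def Ck_on_const)

lemma smooth_on_bounded_linear: "open U \<Longrightarrow> bounded_linear L \<Longrightarrow> smooth_on L U"
  by (simp add: smooth_on_def Ck_on_bounded_linear)

lemma smooth_on_add:
  "open U \<Longrightarrow> smooth_on f U \<Longrightarrow> smooth_on g U \<Longrightarrow> smooth_on (\<lambda>x. f x + g x) U"
  by (simp add: smooth_on_def Ck_on_add)

lemma smooth_on_sum:
  "open U \<Longrightarrow> (\<And>i. i \<in> I \<Longrightarrow> smooth_on (f i) U) \<Longrightarrow> smooth_on (\<lambda>x. \<Sum>i\<in>I. f i x) U"
  by (simp add: smooth_on_def Ck_on_sum)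

lemma smooth_on_mult:
  fixes f g :: "'b::real_normed_vector \<Rightarrow> real"
  shows "open U \<Longrightarrow> smooth_on f U \<Longrightarrow> smooth_on g U \<Longrightarrow> smooth_on (\<lambda>x. f x * g x) U"
  by (simp add: smooth_on_def Ck_on_mult)

lemma smooth_on_compose:
  fixes f :: "'c::euclidean_space \<Rightarrow> real" and g :: "'b::real_normed_vector \<Rightarrow> 'c"
  shows "open U \<Longrightarrow> open V \<Longrightarrow> g ` U \<subseteq> V \<Longrightarrow> smooth_on f V \<Longrightarrow> smooth_on g U \<Longrightarrow>
    smooth_on (\<lambda>x. f (g x)) U"
  by (simp add: smooth_on_def Ck_on_compose)

lemma smooth_on_has_derivative:
  assumes "open U" "smooth_on f U" "x \<in> U"
  shows "(f has_derivative frechet_derivative f (at x)) (at x)"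
proof -
  have "Ck_on (Suc 0) f U" using assms(2) unfolding smooth_on_def by blast
  then show ?thesis using Ck_on_SucD(1) assms by blast
qed

lemma smooth_on_frechet_derivative:
  "open U \<Longrightarrow> smooth_on f U \<Longrightarrow> smooth_on (\<lambda>x. frechet_derivative f (at x) v) U"
  unfolding smooth_on_def using Ck_on_SucD(2) by blast

section \<open>Bump functions\<close>

text \<open>For \<open>m = 0\<close> this is the classical flat function exp(-1/t). The powers of
  1/t make the linear span of the family closed under differentiation, so smoothness follows by one
  induction over all \<open>m\<close> at once.\<close>

definition flat_exp :: "nat \<Rightarrow> real \<Rightarrow> real" where
  "flat_exp m t = (if t > 0 then exp (- inverse t) * inverse t ^ m else 0)"

text \<open>From the right, u = 1/t turns the limit into that of u^m / exp(u) as u tends to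
  infinity.\<close>

lemma flat_exp_tendsto_0: "(flat_exp m \<longlongrightarrow> 0) (at 0)"
proof -
  have "((\<lambda>t. inverse t ^ m / exp (inverse t)) \<longlongrightarrow> 0) (at_right (0::real))"
    by (rule filterlim_compose[OF tendsto_power_div_exp_0 filterlim_inverse_at_top_right])
  then have "((\<lambda>t. exp (- inverse t) * inverse t ^ m) \<longlongrightarrow> 0) (at_right (0::real))"
    by (simp add: exp_minus divide_inverse mult.commute)
  then have "(flat_exp m \<longlongrightarrow> 0) (at_right 0)"
    by (rule Lim_transform_eventually)
      (auto simp: flat_exp_def eventually_at_filter)
  moreover have "(flat_exp m \<longlongrightarrow> 0) (at_left 0)"
    by (rule Lim_transform_eventually[OF tendsto_const])
      (auto simp: flat_exp_def eventually_at_filter)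
  ultimately show ?thesis by (simp add: filterlim_split_at)
qed

lemma flat_exp_has_derivative:
  "(flat_exp m has_field_derivative flat_exp (m + 2) t - real m * flat_exp (m + 1) t) (at t)"
proof -
  consider "t > 0" | "t < 0" | "t = 0" by linarith
  then show ?thesis
  proof cases
    case 1
    have "((\<lambda>t. exp (- inverse t) * inverse t ^ m) has_field_derivative
        (inverse t)\<^sup>2 * exp (- inverse t) * inverse t ^ m
          - (real m * inverse t ^ (m - Suc 0) * (inverse t)\<^sup>2) * exp (- inverse t)) (at t)"
      using 1 by (auto intro!: derivative_eq_intros simp: power2_eq_square)
    \<comment> \<open>For \<open>m = 0\<close> the truncated exponent \<open>m - Suc 0\<close> is
      harmless because the factor \<open>real m\<close> vanishes.\<close>
    moreover have "real m * inverse t ^ (m - Suc 0) * (inverse t)\<^sup>2 = real m * inverse t ^ (m + 1)"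
      by (cases m) (simp_all add: power2_eq_square)
    then have "(inverse t)\<^sup>2 * exp (- inverse t) * inverse t ^ m
          - (real m * inverse t ^ (m - Suc 0) * (inverse t)\<^sup>2) * exp (- inverse t)
        = exp (- inverse t) * inverse t ^ (m + 2) - real m * (exp (- inverse t) * inverse t ^ (m + 1))"
      by (simp only:) (simp add: power2_eq_square mult_ac)
    ultimately have "((\<lambda>t. exp (- inverse t) * inverse t ^ m) has_field_derivative
        exp (- inverse t) * inverse t ^ (m + 2) - real m * (exp (- inverse t) * inverse t ^ (m + 1))) (at t)"
      by (simp only:)
    then have "((\<lambda>t. exp (- inverse t) * inverse t ^ m) has_field_derivative
        flat_exp (m + 2) t - real m * flat_exp (m + 1) t) (at t)"
      using 1 by (simp add: flat_exp_def)
    then show ?thesis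
      by (rule has_field_derivative_transform_within_open[where S = "{0<..}"]) (use 1 in \<open>auto simp: flat_exp_def\<close>)
  next
    case 2
    have "((\<lambda>_. 0) has_field_derivative flat_exp (m + 2) t - real m * flat_exp (m + 1) t) (at t)"
      using 2 by (simp add: flat_exp_def)
    then show ?thesis
      by (rule has_field_derivative_transform_within_open[where S = "{..<0}"]) (use 2 in \<open>auto simp: flat_exp_def\<close>)
  next
    case 3
    \<comment> \<open>The difference quotient at 0 is exactly \<open>flat_exp (m + 1)\<close>, so
      the limit already proved gives derivative 0.\<close>
    have "((\<lambda>s. (flat_exp m s - flat_exp m 0) / (s - 0)) \<longlongrightarrow> 0) (at 0)"
      by (rule Lim_transform_eventually[OF flat_exp_tendsto_0[of "m + 1"]])
        (auto simp: flat_exp_def divide_inverse eventually_at_filter)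
    then show ?thesis
      using 3 by (simp add: has_field_derivative_iff flat_exp_def)
  qed
qed

lemma smooth_on_flat_exp: "smooth_on (flat_exp m) UNIV"
proof -
  have "Ck_on k (flat_exp m) UNIV" for k
  proof (induction k arbitrary: m)
    case 0
    show ?case using flat_exp_has_derivative
      by (auto intro!: continuous_at_imp_continuous_on intro: DERIV_isCont)
  next
    case (Suc k)
    show ?case
    proof (rule Ck_on_SucI)
      show "(flat_exp m has_derivative (\<lambda>v. (flat_exp (m + 2) x + (- real m) * flat_exp (m + 1) x) * v)) (at x)" for x
        using flat_exp_has_derivative[of m x] by (simp add: has_field_derivative_def)
      show "Ck_on k (\<lambda>x. (flat_exp (m + 2) x + (- real m) * flat_exp (m + 1) x) * v) UNIV" for v
        by (intro Ck_on_mult Ck_on_add Ck_on_const open_UNIV Suc)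
    qed simp
  qed
  then show ?thesis by (simp add: smooth_on_def)
qed

text \<open>A normalized exp(-1/(r^2 - |z - y|^2)). It equals 1 at the centre but not on a
  neighbourhood; later uses rely on factors that vanish at the centre to remove its
  derivative.\<close>

lemma bump_function:
  fixes y :: "'b::euclidean_space"
  assumes "r > 0"
  obtains \<psi> :: "'b \<Rightarrow> real" where "smooth_on \<psi> UNIV" "\<psi> y = 1" "\<And>z. z \<notin> cball y r \<Longrightarrow> \<psi> z = 0"
proof -
  \<comment> \<open>The squared distance is written in coordinates so that the closure rules for
    sums and products apply.\<close>
  have sq: "smooth_on (\<lambda>z. r\<^sup>2 + (\<Sum>i\<in>Basis. (-1) * ((z \<bullet> i + - (y \<bullet> i)) * (z \<bullet> i + - (y \<bullet> i))))) (UNIV::'b set)"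
    by (intro smooth_on_add smooth_on_sum smooth_on_mult smooth_on_const open_UNIV
        smooth_on_bounded_linear bounded_linear_inner_left)
  have eq: "r\<^sup>2 + (\<Sum>i\<in>Basis. (-1) * ((z \<bullet> i + - (y \<bullet> i)) * (z \<bullet> i + - (y \<bullet> i)))) = r\<^sup>2 - (dist y z)\<^sup>2" for z
  proof -
    have "(dist y z)\<^sup>2 = (\<Sum>i\<in>Basis. ((y - z) \<bullet> i) * ((y - z) \<bullet> i))"
      by (simp only: dist_norm power2_norm_eq_inner euclidean_inner[of "y - z" "y - z"])
    also have "\<dots> = (\<Sum>i\<in>Basis. (z \<bullet> i + - (y \<bullet> i)) * (z \<bullet> i + - (y \<bullet> i)))"
      by (intro sum.cong refl) (simp add: inner_diff_left algebra_simps)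
    finally show ?thesis by (simp add: sum_negf)
  qed
  have pos: "flat_exp 0 (r\<^sup>2) > 0" using assms by (simp add: flat_exp_def)
  let ?\<psi> = "\<lambda>z. inverse (flat_exp 0 (r\<^sup>2)) * flat_exp 0 (r\<^sup>2 - (dist y z)\<^sup>2)"
  show thesis
  proof
    show "smooth_on ?\<psi> UNIV"
      by (intro smooth_on_mult smooth_on_const open_UNIV
          smooth_on_compose[OF _ _ _ smooth_on_flat_exp] sq[unfolded eq]) auto
    show "?\<psi> y = 1" using pos by simp
    show "?\<psi> z = 0" if "z \<notin> cball y r" for z
    proof -
      have "r\<^sup>2 < (dist y z)\<^sup>2" using that assms by (intro power_strict_mono) auto
      then show ?thesis by (simp add: flat_exp_def)
    qed
  qed
qed

section \<open>Hadamard's lemma\<close>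

text \<open>The weight \<open>\<omega>\<close> makes the statement inductive: differentiating under the integral turns
  \<open>\<omega>(t)\<close> into \<open>t \<omega>(t)\<close>.\<close>

lemma Ck_on_radial_integral:
  fixes G :: "'b::euclidean_space \<Rightarrow> real" and \<omega> :: "real \<Rightarrow> real"
  assumes "continuous_on {0..1} \<omega>" "Ck_on k G (ball y r)"
  shows "Ck_on k (\<lambda>x. integral {0..1} (\<lambda>t. \<omega> t * G (y + t *\<^sub>R (x - y)))) (ball y r)"
  using assms
proof (induction k arbitrary: G \<omega>)
  have seg: "y + t *\<^sub>R (x - y) \<in> ball y r" if "x \<in> ball y r" "t \<in> {0..1}" for x t
  proof -
    have "norm (t *\<^sub>R (x - y)) \<le> norm (x - y)"
      using that(2) by (simp add: mult_left_le_one_le)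
    then show ?thesis using that(1) by (simp add: dist_norm norm_minus_commute)
  qed
  have cont: "continuous_on (ball y r \<times> cbox 0 1) (\<lambda>(x, t). \<omega> t * H (y + t *\<^sub>R (x - y)))"
    if "continuous_on {0..1} \<omega>" "continuous_on (ball y r) H" for \<omega> :: "real \<Rightarrow> real" and H :: "'b \<Rightarrow> real"
    unfolding split_beta
    by (intro continuous_on_mult continuous_on_compose2[OF that(1)] continuous_on_compose2[OF that(2)]
        continuous_intros) (use seg in auto)
  {
    case 0
    then show ?case using integral_continuous_on_param[OF cont] by simp
  next
    case (Suc k)
    let ?F' = "\<lambda>x v. integral {0..1} (\<lambda>t. (t * \<omega> t) * frechet_derivative G (at (y + t *\<^sub>R (x - y))) v)"
    have \<omega>: "continuous_on {0..1} (\<lambda>t. t * \<omega> t)"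
      by (intro continuous_intros Suc.prems)
    note G' = Ck_on_SucD[OF open_ball Suc.prems(2)]
    have contG: "continuous_on (ball y r) G" by (rule Ck_on_continuous[OF Suc.prems(2)])
    show ?case
    proof (rule Ck_on_SucI[OF open_ball])
      show "Ck_on k (\<lambda>x. ?F' x v) (ball y r)" for v
        by (rule Suc.IH[OF \<omega> G'(2)])
    next
      fix x0 assume x0: "x0 \<in> ball y r"
      \<comment> \<open>The Leibniz rule for integrals asks for the derivative as a bounded linear
        map depending jointly continuously on both variables; in finite dimension that continuity
        can be tested on basis vectors.\<close>
      define fx where "fx x t = (t * \<omega> t) *\<^sub>R Blinfun (frechet_derivative G (at (y + t *\<^sub>R (x - y))))" for x t
      have fx: "blinfun_apply (fx x t) v = (t * \<omega> t) * frechet_derivative G (at (y + t *\<^sub>R (x - y))) v"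
        if "x \<in> ball y r" "t \<in> {0..1}" for x t v
        using has_derivative_bounded_linear[OF G'(1)[OF seg[OF that]]]
        by (simp add: fx_def scaleR_blinfun.rep_eq bounded_linear_Blinfun_apply)
      have cont_fx: "continuous_on (ball y r \<times> cbox 0 1) (\<lambda>(x, t). fx x t)"
      proof (rule continuous_on_blinfun_componentwise)
        fix i :: 'b assume "i \<in> Basis"
        have "continuous_on (ball y r \<times> cbox 0 1)
           (\<lambda>(x, t). (t * \<omega> t) * frechet_derivative G (at (y + t *\<^sub>R (x - y))) i)"
          by (rule cont[OF \<omega>]) (rule Ck_on_continuous[OF G'(2)])
        then show "continuous_on (ball y r \<times> cbox 0 1) (\<lambda>p. blinfun_apply (case p of (x, t) \<Rightarrow> fx x t) i)"
          by (rule continuous_on_eq) (auto simp: fx)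
      qed
      have "((\<lambda>x. integral (cbox 0 1) (\<lambda>t. \<omega> t * G (y + t *\<^sub>R (x - y)))) has_derivative
          integral (cbox 0 1) (fx x0)) (at x0 within ball y r)"
      proof (rule leibniz_rule)
        fix x t assume xt: "x \<in> ball y r" "t \<in> cbox 0 (1::real)"
        then have t: "t \<in> {0..1}" by simp
        interpret bounded_linear "frechet_derivative G (at (y + t *\<^sub>R (x - y)))"
          by (rule has_derivative_bounded_linear[OF G'(1)[OF seg[OF xt(1) t]]])
        have path: "((\<lambda>x. y + t *\<^sub>R (x - y)) has_derivative (\<lambda>v. t *\<^sub>R v)) (at x)"
          by (auto intro!: derivative_eq_intros)
        have "((\<lambda>x. G (y + t *\<^sub>R (x - y))) has_derivative
            (\<lambda>v. frechet_derivative G (at (y + t *\<^sub>R (x - y))) (t *\<^sub>R v))) (at x)"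
          by (rule has_derivative_compose[OF path G'(1)[OF seg[OF xt(1) t]]])
        then have "((\<lambda>x. \<omega> t * G (y + t *\<^sub>R (x - y))) has_derivative blinfun_apply (fx x t)) (at x)"
          by (rule has_derivative_eq_rhs[OF has_derivative_mult_right])
            (auto simp: fx[OF xt(1) t] scaleR fun_eq_iff)
        then show "((\<lambda>x. \<omega> t * G (y + t *\<^sub>R (x - y))) has_derivative blinfun_apply (fx x t))
            (at x within ball y r)" by (rule has_derivative_at_withinI)
      next
        fix x assume x: "x \<in> ball y r"
        have "continuous_on (cbox 0 1) (\<lambda>t. \<omega> t * G (y + t *\<^sub>R (x - y)))"
          by (rule continuous_on_compose2[OF cont[OF Suc.prems(1) contG], of "cbox 0 1" "\<lambda>t. (x, t)",
                unfolded prod.case]) (use x in \<open>auto intro!: continuous_intros\<close>)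
        then show "(\<lambda>t. \<omega> t * G (y + t *\<^sub>R (x - y))) integrable_on cbox 0 1"
          by (rule integrable_continuous)
      next
        show "continuous_on (ball y r \<times> cbox 0 1) (\<lambda>(x, t). fx x t)" by (rule cont_fx)
      qed (use x0 in auto)
      then have "((\<lambda>x. integral {0..1} (\<lambda>t. \<omega> t * G (y + t *\<^sub>R (x - y)))) has_derivative
          blinfun_apply (integral (cbox 0 1) (fx x0))) (at x0)"
        using x0 by (simp add: at_within_open[OF _ open_ball])
      moreover have "blinfun_apply (integral (cbox 0 1) (fx x0)) = ?F' x0"
      proof
        fix v
        have "fx x0 integrable_on cbox 0 1"
          by (rule integrable_continuous, rule continuous_on_compose2[OF cont_fx, of "cbox 0 1" "\<lambda>t. (x0, t)",
                unfolded prod.case]) (use x0 in \<open>auto intro!: continuous_intros\<close>)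
        then have "blinfun_apply (integral (cbox 0 1) (fx x0)) v = integral (cbox 0 1) (\<lambda>t. blinfun_apply (fx x0 t) v)"
          by (rule blinfun_apply_integral)
        also have "\<dots> = ?F' x0 v"
          by (simp, rule integral_cong) (use fx[OF x0] in simp)
        finally show "blinfun_apply (integral (cbox 0 1) (fx x0)) v = ?F' x0 v" .
      qed
      ultimately show "((\<lambda>x. integral {0..1} (\<lambda>t. \<omega> t * G (y + t *\<^sub>R (x - y)))) has_derivative ?F' x0) (at x0)"
        by (simp only:)
    qed
  }
qed

text \<open>The fundamental theorem of calculus along the segment from \<open>y\<close> to
  \<open>x\<close>: \<open>G i\<close> is the average over the segment of the i-th partial
  derivative, and is smooth because one may differentiate under the integral.\<close>

lemma hadamard:
  fixes f :: "'b::euclidean_space \<Rightarrow> real"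
  assumes "smooth_on f (ball y r)"
  obtains G where "\<And>i. smooth_on (G i) (ball y r)" "\<And>i. G i y = frechet_derivative f (at y) i"
    "\<And>x. x \<in> ball y r \<Longrightarrow> f x = f y + (\<Sum>i\<in>Basis. ((x - y) \<bullet> i) * G i x)"
proof
  \<comment> \<open>The literal factor 1 is the weight \<omega> of
    \<open>Ck_on_radial_integral\<close>.\<close>
  let ?G = "\<lambda>i x. integral {0..1} (\<lambda>t. 1 * frechet_derivative f (at (y + t *\<^sub>R (x - y))) i)"
  show "smooth_on (?G i) (ball y r)" for i
    unfolding smooth_on_def
    using smooth_on_frechet_derivative[OF open_ball assms, of i]
    by (intro allI Ck_on_radial_integral) (auto simp: smooth_on_def)
  show "?G i y = frechet_derivative f (at y) i" for i by simp
  fix x assume x: "x \<in> ball y r"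
  have seg: "y + t *\<^sub>R (x - y) \<in> ball y r" if "t \<in> {0..1}" for t
  proof -
    have "norm (t *\<^sub>R (x - y)) \<le> norm (x - y)"
      using that by (simp add: mult_left_le_one_le)
    then show ?thesis using x by (simp add: dist_norm norm_minus_commute)
  qed
  let ?f' = "\<lambda>t. frechet_derivative f (at (y + t *\<^sub>R (x - y)))"
  have "((\<lambda>t. f (y + t *\<^sub>R (x - y))) has_vector_derivative ?f' t (x - y)) (at t within {0..1})"
    if "t \<in> {0..1}" for t
  proof -
    have f': "(f has_derivative ?f' t) (at (y + t *\<^sub>R (x - y)))"
      by (rule smooth_on_has_derivative[OF open_ball assms seg[OF that]])
    have path: "((\<lambda>t. y + t *\<^sub>R (x - y)) has_derivative (\<lambda>s. s *\<^sub>R (x - y))) (at t)"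
      by (auto intro!: derivative_eq_intros)
    have "((\<lambda>t. f (y + t *\<^sub>R (x - y))) has_derivative (\<lambda>s. ?f' t (s *\<^sub>R (x - y)))) (at t)"
      by (rule has_derivative_compose[OF path f'])
    then show ?thesis
      unfolding has_vector_derivative_def
      using linear_cmul[OF has_derivative_linear[OF f']] by (auto intro: has_derivative_at_withinI)
  qed
  then have "((\<lambda>t. ?f' t (x - y)) has_integral f (y + 1 *\<^sub>R (x - y)) - f (y + 0 *\<^sub>R (x - y))) {0..1}"
    by (intro fundamental_theorem_of_calculus) auto
  then have "f x = f y + integral {0..1} (\<lambda>t. ?f' t (x - y))"
    by (simp add: integral_unique)
  also have "integral {0..1} (\<lambda>t. ?f' t (x - y)) = integral {0..1} (\<lambda>t. \<Sum>i\<in>Basis. ((x - y) \<bullet> i) * (1 * ?f' t i))"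
  proof (rule integral_cong)
    fix t :: real assume "t \<in> {0..1}"
    note lin = has_derivative_linear[OF smooth_on_has_derivative[OF open_ball assms seg[OF this]]]
    have "?f' t (x - y) = ?f' t (\<Sum>i\<in>Basis. ((x - y) \<bullet> i) *\<^sub>R i)"
      by (simp only: euclidean_representation)
    also have "\<dots> = (\<Sum>i\<in>Basis. ((x - y) \<bullet> i) * (1 * ?f' t i))"
      by (simp only: linear_sum[OF lin] linear_cmul[OF lin] real_scaleR_def mult_1)
    finally show "?f' t (x - y) = (\<Sum>i\<in>Basis. ((x - y) \<bullet> i) * (1 * ?f' t i))" .
  qed
  also have "\<dots> = (\<Sum>i\<in>Basis. ((x - y) \<bullet> i) * ?G i x)"
  proof (subst integral_sum)
    fix i :: 'b
    have "continuous_on (ball y r) (\<lambda>x. frechet_derivative f (at x) i)"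
      using smooth_on_frechet_derivative[OF open_ball assms, of i] Ck_on_continuous
      unfolding smooth_on_def by blast
    then have "continuous_on {0..1} (\<lambda>t. ?f' t i)"
      by (rule continuous_on_compose2) (use seg in \<open>auto intro!: continuous_intros\<close>)
    then show "(\<lambda>t. ((x - y) \<bullet> i) * (1 * ?f' t i)) integrable_on {0..1}"
      by (intro integrable_continuous_interval continuous_intros) simp
  qed simp_all
  finally show "f x = f y + (\<Sum>i\<in>Basis. ((x - y) \<bullet> i) * ?G i x)" .
qed

section \<open>Smooth functions and tangent vectors\<close>

lemma sum_fun_apply: "(\<Sum>i\<in>I. F i) x = (\<Sum>i\<in>I. F i x)"
  by (induction I rule: infinite_finite_induct) (simp_all add: zero_fun_def)

lemma tscale_apply [simp]: "(c *\<^sub>t v) f = c * v f"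
  by (simp add: tscale_def)

locale smooth_manifold =
  fixes A :: "('a::{t2_space, second_countable_topology}, 'b::euclidean_space) atlas"
  assumes atlas: "smooth_atlas A"
begin

lemma chart:
  assumes "(U, c) \<in> A"
  shows "open U" "open (c ` U)" "homeomorphism U (c ` U) c (inv_into U c)"
  using atlas assms unfolding smooth_atlas_def by fast+

lemma chart_at: obtains U c where "(U, c) \<in> A" "p \<in> U"
proof -
  have "p \<in> (\<Union>(U, c) \<in> A. U)" using atlas unfolding smooth_atlas_def by blast
  then show thesis using that by blast
qed

lemma chart_inv:
  assumes "(U, c) \<in> A"
  shows "q \<in> U \<Longrightarrow> inv_into U c (c q) = q"
    and "y \<in> c ` U \<Longrightarrow> c (inv_into U c y) = y"
    and "y \<in> c ` U \<Longrightarrow> inv_into U c y \<in> U"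
  using chart(3)[OF assms] by (auto simp: homeomorphism_def)

lemma open_chart_image:
  assumes "(U, c) \<in> A" "open V" "V \<subseteq> U"
  shows "open (c ` V)"
  using homeomorphism_imp_open_map[OF chart(3)[OF assms(1)], of V] chart(1,2)[OF assms(1)] assms(2,3)
  by (meson open_openin_trans openin_open_eq openin_trans open_subset)

lemma chart_transition:
  assumes "(U, c) \<in> A" "(V, d) \<in> A"
  shows "smooth_on (d \<circ> inv_into U c) (c ` (U \<inter> V))"
  using atlas assms unfolding smooth_atlas_def by fast

lemma smooth_funD: "f \<in> smooth_fun A \<Longrightarrow> (U, c) \<in> A \<Longrightarrow> smooth_on (f \<circ> inv_into U c) (c ` U)"
  unfolding smooth_fun_def by blast

lemma smooth_funI:
  "(\<And>U c. (U, c) \<in> A \<Longrightarrow> smooth_on (f \<circ> inv_into U c) (c ` U)) \<Longrightarrow> f \<in> smooth_fun A"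
  unfolding smooth_fun_def by blast

lemma smooth_fun_const [simp]: "(\<lambda>_. a) \<in> smooth_fun A"
  by (rule smooth_funI) (simp add: o_def smooth_on_const chart)

lemma smooth_fun_0 [simp]: "0 \<in> smooth_fun A" and smooth_fun_1 [simp]: "1 \<in> smooth_fun A"
  using smooth_fun_const[of 0] smooth_fun_const[of 1] by (simp_all add: zero_fun_def one_fun_def)

lemma smooth_fun_add [simp]:
  assumes "f \<in> smooth_fun A" "h \<in> smooth_fun A"
  shows "f + h \<in> smooth_fun A"
proof (rule smooth_funI)
  fix U c assume c: "(U, c) \<in> A"
  show "smooth_on ((f + h) \<circ> inv_into U c) (c ` U)"
    using smooth_on_add[OF chart(2)[OF c] smooth_funD[OF assms(1) c] smooth_funD[OF assms(2) c]]
    by (simp add: o_def)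
qed

lemma smooth_fun_mult [simp]:
  assumes "f \<in> smooth_fun A" "h \<in> smooth_fun A"
  shows "f * h \<in> smooth_fun A"
proof (rule smooth_funI)
  fix U c assume c: "(U, c) \<in> A"
  show "smooth_on ((f * h) \<circ> inv_into U c) (c ` U)"
    using smooth_on_mult[OF chart(2)[OF c] smooth_funD[OF assms(1) c] smooth_funD[OF assms(2) c]]
    by (simp add: o_def)
qed

lemma smooth_fun_cmult [simp]: "f \<in> smooth_fun A \<Longrightarrow> (\<lambda>q. a * f q) \<in> smooth_fun A"
  using smooth_fun_mult[OF smooth_fun_const[of a], of f] by (simp add: times_fun_def)

lemma smooth_fun_uminus [simp]: "f \<in> smooth_fun A \<Longrightarrow> - f \<in> smooth_fun A"
  using smooth_fun_cmult[of f "-1"] by (simp add: fun_Compl_def)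

lemma smooth_fun_diff [simp]: "f \<in> smooth_fun A \<Longrightarrow> h \<in> smooth_fun A \<Longrightarrow> f - h \<in> smooth_fun A"
  using smooth_fun_add[of f "- h"] by simp

text \<open>The source of all global smooth functions built from a chart. Since \<open>h\<close>
  vanishes off a compact subset of \<open>W\<close>, it is smooth on the whole chart image; the
  remaining issue is smoothness at the boundary of \<open>U\<close>, seen from other charts.\<close>

lemma smooth_fun_zero_extension:
  assumes c: "(U, c) \<in> A" and W: "open W" "W \<subseteq> c ` U" "smooth_on h W"
    and K: "compact K" "K \<subseteq> W" "\<And>y. y \<notin> K \<Longrightarrow> h y = 0"
  shows "(\<lambda>q. if q \<in> U then h (c q) else 0) \<in> smooth_fun A"
proof (rule smooth_funI)
  have h: "smooth_on h (c ` U)"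
  proof (rule smooth_on_local[OF chart(2)[OF c]])
    fix y assume "y \<in> c ` U"
    show "\<exists>V. open V \<and> y \<in> V \<and> smooth_on h V"
    proof (cases "y \<in> W")
      case True then show ?thesis using W by blast
    next
      case False
      have op: "open (- K)" by (intro open_Compl compact_imp_closed K(1))
      have "smooth_on h (- K)"
        by (rule smooth_on_cong[OF op _ smooth_on_const[OF op, of 0]]) (use K(3) in auto)
      then show ?thesis using False K(2) op by blast
    qed
  qed
  \<comment> \<open>Compact, hence closed in a Hausdorff space. Since \<open>C\<close> lies in
    \<open>U\<close>, every other chart domain \<open>V\<close> is covered by its intersection with
    \<open>U\<close>, where the transition map applies, and by \<open>V - C\<close>, where the
    extension is 0.\<close>
  define C where "C = inv_into U c ` K"
  have "continuous_on K (inv_into U c)"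
    by (rule continuous_on_subset[OF homeomorphism_cont2[OF chart(3)[OF c]] order_trans[OF K(2) W(2)]])
  then have C: "closed C"
    unfolding C_def using K(1) by (simp add: compact_continuous_image compact_imp_closed)
  let ?F = "\<lambda>q. if q \<in> U then h (c q) else 0"
  fix V d assume d: "(V, d) \<in> A"
  show "smooth_on (?F \<circ> inv_into V d) (d ` V)"
  proof (rule smooth_on_local[OF chart(2)[OF d]])
    fix y assume y: "y \<in> d ` V"
    show "\<exists>W. open W \<and> y \<in> W \<and> smooth_on (?F \<circ> inv_into V d) W"
    proof (cases "inv_into V d y \<in> U")
      case True
      have op: "open (d ` (V \<inter> U))"
        by (rule open_chart_image[OF d]) (use chart(1) c d in auto)
      have "smooth_on (\<lambda>x. h ((c \<circ> inv_into V d) x)) (d ` (V \<inter> U))"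
        by (rule smooth_on_compose[OF op chart(2)[OF c] _ h chart_transition[OF d c]])
          (auto simp: chart_inv[OF d])
      then have "smooth_on (?F \<circ> inv_into V d) (d ` (V \<inter> U))"
        by (rule smooth_on_cong[OF op, rotated]) (auto simp: chart_inv[OF d])
      moreover have "y \<in> d ` (V \<inter> U)"
        using True y chart_inv[OF d] by (metis IntI image_eqI)
      ultimately show ?thesis using op by blast
    next
      case False
      have op: "open (d ` (V - C))"
        by (rule open_chart_image[OF d]) (use chart(1)[OF d] C in auto)
      have "smooth_on (?F \<circ> inv_into V d) (d ` (V - C))"
      proof (rule smooth_on_cong[OF op _ smooth_on_const[OF op, of 0]])
        fix x assume "x \<in> d ` (V - C)"
        then have "inv_into V d x \<notin> C" using chart_inv[OF d] by auto
        then have "h (c (inv_into V d x)) = 0" if "inv_into V d x \<in> U"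
          using that K(3) chart_inv(1)[OF c that] unfolding C_def by (metis image_eqI)
        then show "0 = (?F \<circ> inv_into V d) x" by simp
      qed
      moreover have "inv_into V d y \<notin> C"
        using False subsetD[OF order_trans[OF K(2) W(2)], THEN chart_inv(3)[OF c]]
        unfolding C_def by (metis imageE)
      then have "y \<in> d ` (V - C)"
        using y chart_inv[OF d] by (metis Diff_iff image_eqI)
      ultimately show ?thesis using op by blast
    qed
  qed
qed

section \<open>Derivations at a point\<close>

lemma tangentD:
  assumes "v \<in> tangent_space A p"
  shows "f \<notin> smooth_fun A \<Longrightarrow> v f = 0"
    and "f \<in> smooth_fun A \<Longrightarrow> h \<in> smooth_fun A \<Longrightarrow> v (f + h) = v f + v h"
    and "f \<in> smooth_fun A \<Longrightarrow> v (\<lambda>q. a * f q) = a * v f"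
    and "f \<in> smooth_fun A \<Longrightarrow> h \<in> smooth_fun A \<Longrightarrow> v (f * h) = f p * v h + h p * v f"
  using assms unfolding tangent_space_def by blast+

lemma tangentI:
  assumes "\<And>f. f \<notin> smooth_fun A \<Longrightarrow> v f = 0"
    and "\<And>f h. f \<in> smooth_fun A \<Longrightarrow> h \<in> smooth_fun A \<Longrightarrow> v (f + h) = v f + v h"
    and "\<And>a f. f \<in> smooth_fun A \<Longrightarrow> v (\<lambda>q. a * f q) = a * v f"
    and "\<And>f h. f \<in> smooth_fun A \<Longrightarrow> h \<in> smooth_fun A \<Longrightarrow> v (f * h) = f p * v h + h p * v f"
  shows "v \<in> tangent_space A p"
  using assms unfolding tangent_space_def by blast

lemma tangent_const:
  assumes "v \<in> tangent_space A p"
  shows "v (\<lambda>_. a) = 0"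
proof -
  have "v (1 * 1) = v 1 + v 1" by (subst tangentD(4)[OF assms]) simp_all
  then have "v 1 = 0" by simp
  then show ?thesis using tangentD(3)[OF assms smooth_fun_1, of a] by simp
qed

lemma tangent_0: "v \<in> tangent_space A p \<Longrightarrow> v 0 = 0"
  using tangent_const[of v p 0] by (simp add: zero_fun_def)

lemma tangent_diff:
  assumes "v \<in> tangent_space A p" "f \<in> smooth_fun A" "h \<in> smooth_fun A"
  shows "v (f - h) = v f - v h"
  using tangentD(2)[OF assms(1), of "f - h" h] assms(2,3) by simp

lemma tangent_sum:
  assumes "v \<in> tangent_space A p" "\<And>i. i \<in> I \<Longrightarrow> h i \<in> smooth_fun A"
  shows "(\<Sum>i\<in>I. h i) \<in> smooth_fun A" "v (\<Sum>i\<in>I. h i) = (\<Sum>i\<in>I. v (h i))"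
proof -
  have "(\<Sum>i\<in>I. h i) \<in> smooth_fun A \<and> v (\<Sum>i\<in>I. h i) = (\<Sum>i\<in>I. v (h i))"
    using assms(2)
    by (induction I rule: infinite_finite_induct) (simp_all add: tangent_0[OF assms(1)] tangentD(2)[OF assms(1)])
  then show "(\<Sum>i\<in>I. h i) \<in> smooth_fun A" "v (\<Sum>i\<in>I. h i) = (\<Sum>i\<in>I. v (h i))" by auto
qed

lemma tangent_space_subspace: "tvec.subspace (tangent_space A p)"
proof (rule tvec.subspaceI)
  show "0 \<in> tangent_space A p" by (rule tangentI) auto
  show "u + v \<in> tangent_space A p" if "u \<in> tangent_space A p" "v \<in> tangent_space A p" for u v
    using that by (intro tangentI) (auto simp: tangentD algebra_simps)
  show "c *\<^sub>t v \<in> tangent_space A p" if "v \<in> tangent_space A p" for c v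
    using that by (intro tangentI) (auto simp: tangentD algebra_simps)
qed

lemmas tangent_space_closed [simp] =
  tvec.subspace_0[OF tangent_space_subspace] tvec.subspace_add[OF tangent_space_subspace]
  tvec.subspace_diff[OF tangent_space_subspace] tvec.subspace_neg[OF tangent_space_subspace]
  tvec.subspace_scale[OF tangent_space_subspace]

section \<open>Vector fields\<close>

lemma vfieldsD:
  assumes "X \<in> vfields A"
  shows "X p \<in> tangent_space A p" "f \<in> smooth_fun A \<Longrightarrow> deriv_along X f \<in> smooth_fun A"
  using assms unfolding vfields_def by blast+

lemma vfieldsI:
  "(\<And>p. X p \<in> tangent_space A p) \<Longrightarrow> (\<And>f. f \<in> smooth_fun A \<Longrightarrow> deriv_along X f \<in> smooth_fun A) \<Longrightarrow>
    X \<in> vfields A"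
  unfolding vfields_def by blast

lemma vfields_0 [simp]: "0 \<in> vfields A"
  by (rule vfieldsI) (auto simp: deriv_along_def)

lemma vfields_add [simp]:
  assumes "X \<in> vfields A" "Y \<in> vfields A"
  shows "X + Y \<in> vfields A"
proof (rule vfieldsI)
  show "deriv_along (X + Y) f \<in> smooth_fun A" if "f \<in> smooth_fun A" for f
    using smooth_fun_add[OF vfieldsD(2)[OF assms(1) that] vfieldsD(2)[OF assms(2) that]]
    by (simp add: deriv_along_def plus_fun_def)
qed (simp add: assms vfieldsD)

lemma vfields_fscale [simp]:
  assumes "h \<in> smooth_fun A" "X \<in> vfields A"
  shows "h \<odot> X \<in> vfields A"
proof (rule vfieldsI)
  show "deriv_along (h \<odot> X) f \<in> smooth_fun A" if "f \<in> smooth_fun A" for f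
    using smooth_fun_mult[OF assms(1) vfieldsD(2)[OF assms(2) that]]
    by (simp add: deriv_along_def times_fun_def fscale_def)
qed (simp add: assms vfieldsD fscale_def)

lemma vfields_uminus [simp]: "X \<in> vfields A \<Longrightarrow> - X \<in> vfields A"
  using vfields_fscale[OF smooth_fun_const[of "-1"], of X]
  by (simp add: fscale_def tscale_def fun_Compl_def)

lemma vfields_diff [simp]: "X \<in> vfields A \<Longrightarrow> Y \<in> vfields A \<Longrightarrow> X - Y \<in> vfields A"
  using vfields_add[of X "- Y"] by simp

lemma deriv_along_add:
  "X \<in> vfields A \<Longrightarrow> f \<in> smooth_fun A \<Longrightarrow> h \<in> smooth_fun A \<Longrightarrow>
    deriv_along X (f + h) = deriv_along X f + deriv_along X h"
  by (auto simp: deriv_along_def fun_eq_iff tangentD(2)[OF vfieldsD(1)])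

lemma deriv_along_mult:
  "X \<in> vfields A \<Longrightarrow> f \<in> smooth_fun A \<Longrightarrow> h \<in> smooth_fun A \<Longrightarrow>
    deriv_along X (f * h) = f * deriv_along X h + h * deriv_along X f"
  by (auto simp: deriv_along_def fun_eq_iff tangentD(4)[OF vfieldsD(1)])

lemma vfields_lie_bracket [simp]:
  assumes X: "X \<in> vfields A" and Y: "Y \<in> vfields A"
  shows "lie_bracket X Y \<in> vfields A"
proof (rule vfieldsI)
  fix p
  note tX = tangentD[OF vfieldsD(1)[OF X]] and tY = tangentD[OF vfieldsD(1)[OF Y]]
    and sX = vfieldsD(2)[OF X] and sY = vfieldsD(2)[OF Y]
  show "lie_bracket X Y p \<in> tangent_space A p"
  proof (rule tangentI)
    fix f assume "f \<notin> smooth_fun A"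
    then have "deriv_along X f = 0" "deriv_along Y f = 0"
      by (auto simp: deriv_along_def fun_eq_iff tX(1) tY(1))
    then show "lie_bracket X Y p f = 0"
      by (simp add: lie_bracket_def tangent_0[OF vfieldsD(1)[OF X]] tangent_0[OF vfieldsD(1)[OF Y]])
  next
    fix f h assume fh: "f \<in> smooth_fun A" "h \<in> smooth_fun A"
    show "lie_bracket X Y p (f + h) = lie_bracket X Y p f + lie_bracket X Y p h"
      by (simp add: lie_bracket_def deriv_along_add X Y fh tX tY sX sY)
    show "lie_bracket X Y p (f * h) = f p * lie_bracket X Y p h + h p * lie_bracket X Y p f"
      by (simp add: lie_bracket_def deriv_along_mult X Y fh tX tY sX sY)
        (simp add: deriv_along_def algebra_simps)
  next
    fix a f assume f: "f \<in> smooth_fun A"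
    have "deriv_along X (\<lambda>q. a * f q) = (\<lambda>q. a * deriv_along X f q)"
      "deriv_along Y (\<lambda>q. a * f q) = (\<lambda>q. a * deriv_along Y f q)"
      by (auto simp: deriv_along_def fun_eq_iff tX(3)[OF f] tY(3)[OF f])
    then show "lie_bracket X Y p (\<lambda>q. a * f q) = a * lie_bracket X Y p f"
      by (simp add: lie_bracket_def tX(3)[OF sY[OF f]] tY(3)[OF sX[OF f]] algebra_simps)
  qed
next
  fix f assume f: "f \<in> smooth_fun A"
  have "deriv_along (lie_bracket X Y) f = deriv_along X (deriv_along Y f) - deriv_along Y (deriv_along X f)"
    by (simp add: deriv_along_def lie_bracket_def fun_eq_iff)
  then show "deriv_along (lie_bracket X Y) f \<in> smooth_fun A"
    using f by (simp add: vfieldsD(2) X Y)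
qed

lemma deriv_along_lie_bracket:
  "deriv_along (lie_bracket X Y) f = deriv_along X (deriv_along Y f) - deriv_along Y (deriv_along X f)"
  by (simp add: deriv_along_def lie_bracket_def fun_eq_iff)

section \<open>Bases of tangent spaces\<close>

text \<open>The coordinate field of direction \<open>i\<close>, cut off by \<psi> to make it global.
  The test on \<open>f\<close> follows the convention that tangent vectors are 0 on non-smooth
  functions.\<close>

definition coord_field :: "'a set \<Rightarrow> ('a \<Rightarrow> 'b) \<Rightarrow> ('b \<Rightarrow> real) \<Rightarrow> 'b \<Rightarrow> 'a vfield" where
  "coord_field U c \<psi> i = (\<lambda>q f. if f \<in> smooth_fun A \<and> q \<in> U
     then \<psi> (c q) * frechet_derivative (f \<circ> inv_into U c) (at (c q)) i else 0)"

lemma coord_field_vfields: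
  assumes c: "(U, c) \<in> A" and \<psi>: "smooth_on \<psi> UNIV" "\<And>y. y \<notin> K \<Longrightarrow> \<psi> y = 0"
    and K: "compact K" "K \<subseteq> c ` U"
  shows "coord_field U c \<psi> i \<in> vfields A"
proof (rule vfieldsI)
  fix q
  show "coord_field U c \<psi> i q \<in> tangent_space A q"
  proof (cases "q \<in> U")
    case False
    then have "coord_field U c \<psi> i q = 0" by (simp add: coord_field_def fun_eq_iff)
    then show ?thesis by simp
  next
    case True
    let ?d = "\<lambda>f. frechet_derivative (f \<circ> inv_into U c) (at (c q))"
    have d: "((f \<circ> inv_into U c) has_derivative ?d f) (at (c q))" if "f \<in> smooth_fun A" for f
      by (rule smooth_on_has_derivative[OF chart(2)[OF c] smooth_funD[OF that c]]) (use True in simp)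
    show ?thesis
    proof (rule tangentI)
      fix f h assume fh: "f \<in> smooth_fun A" "h \<in> smooth_fun A"
      have "(\<lambda>v. ?d f v + ?d h v) = ?d (f + h)"
        by (rule frechet_derivative_at)
          (use has_derivative_add[OF d[OF fh(1)] d[OF fh(2)]] in \<open>simp add: o_def\<close>)
      then have "?d (f + h) i = ?d f i + ?d h i" by (simp add: fun_eq_iff)
      then show "coord_field U c \<psi> i q (f + h) = coord_field U c \<psi> i q f + coord_field U c \<psi> i q h"
        using fh by (simp add: coord_field_def algebra_simps)
      have "(\<lambda>v. f q * ?d h v + ?d f v * h q) = ?d (f * h)"
        by (rule frechet_derivative_at)
          (use has_derivative_mult[OF d[OF fh(1)] d[OF fh(2)]] chart_inv(1)[OF c True] in \<open>simp add: o_def\<close>)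
      then have "?d (f * h) i = f q * ?d h i + ?d f i * h q" by (simp add: fun_eq_iff)
      then show "coord_field U c \<psi> i q (f * h) = f q * coord_field U c \<psi> i q h + h q * coord_field U c \<psi> i q f"
        using fh by (simp add: coord_field_def algebra_simps)
    next
      fix a f assume f: "f \<in> smooth_fun A"
      have "(\<lambda>v. a * ?d f v) = ?d (\<lambda>q. a * f q)"
        by (rule frechet_derivative_at) (use has_derivative_mult_right[OF d[OF f]] in \<open>simp add: o_def\<close>)
      then have "?d (\<lambda>q. a * f q) i = a * ?d f i" by (simp add: fun_eq_iff)
      then show "coord_field U c \<psi> i q (\<lambda>q. a * f q) = a * coord_field U c \<psi> i q f"
        using f by (simp add: coord_field_def algebra_simps)
    qed (simp add: coord_field_def)
  qed
next
  fix f assume f: "f \<in> smooth_fun A"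
  have "(\<lambda>q. if q \<in> U then \<psi> (c q) * frechet_derivative (f \<circ> inv_into U c) (at (c q)) i else 0) \<in> smooth_fun A"
    using chart(2)[OF c] smooth_funD[OF f c] K \<psi>(2)
    by (intro smooth_fun_zero_extension[OF c _ order_refl, where K = K and
          h = "\<lambda>y. \<psi> y * frechet_derivative (f \<circ> inv_into U c) (at y) i"]
        smooth_on_mult smooth_on_frechet_derivative smooth_on_subset[OF open_UNIV _ _ \<psi>(1)]) auto
  then show "deriv_along (coord_field U c \<psi> i) f \<in> smooth_fun A"
    using f by (simp add: deriv_along_def coord_field_def)
qed

text \<open>Coordinate derivations are independent because they are dual to cut-off coordinate
  functions. They span because Hadamard's lemma, multiplied by cut-offs to become an identity of
  global smooth functions, shows that a derivation is determined by its values on those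
  coordinates.\<close>

lemma tangent_space_frame:
  obtains E :: "'b \<Rightarrow> 'a vfield" where "\<And>i. E i \<in> vfields A" "inj_on (\<lambda>i. E i p) Basis"
    "tvec.independent ((\<lambda>i. E i p) ` Basis)" "tvec.span ((\<lambda>i. E i p) ` Basis) = tangent_space A p"
proof -
  obtain U c where c: "(U, c) \<in> A" and p: "p \<in> U" by (rule chart_at)
  have cp: "c p \<in> c ` U" using p by simp
  obtain r where r: "r > 0" "ball (c p) r \<subseteq> c ` U"
    using open_contains_ball chart(2)[OF c] cp by blast
  define K where "K = cball (c p) (r / 2)"
  have K: "compact K" "K \<subseteq> ball (c p) r" "K \<subseteq> c ` U"
    using r by (auto simp: K_def)
  obtain \<psi> :: "'b \<Rightarrow> real" where \<psi>: "smooth_on \<psi> UNIV" "\<psi> (c p) = 1" "\<And>y. y \<notin> K \<Longrightarrow> \<psi> y = 0"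
    using bump_function[of "r / 2" "c p"] r(1) unfolding K_def by auto
  define E where "E = coord_field U c \<psi>"
  have E: "E i \<in> vfields A" for i
    unfolding E_def by (rule coord_field_vfields[OF c \<psi>(1,3) K(1,3)])
  have ext: "(\<lambda>q. if q \<in> U then \<psi> (c q) * h (c q) else 0) \<in> smooth_fun A"
    if "smooth_on h (ball (c p) r)" for h
    using r(2) K(1,2) \<psi>(3) that
    by (intro smooth_fun_zero_extension[OF c open_ball, where K = K and h = "\<lambda>y. \<psi> y * h y"]
        smooth_on_mult smooth_on_subset[OF open_UNIV _ _ \<psi>(1)]) auto
  define x where "x i = (\<lambda>q. if q \<in> U then \<psi> (c q) * ((c q - c p) \<bullet> i) else 0)" for i
  have lin: "smooth_on (\<lambda>y. (y - c p) \<bullet> i) UNIV" for i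
    using smooth_on_add[OF open_UNIV smooth_on_bounded_linear[OF open_UNIV bounded_linear_inner_left, of i]
        smooth_on_const[OF open_UNIV, of "- (c p \<bullet> i)"]]
    by (simp add: inner_diff_left)
  have x: "x i \<in> smooth_fun A" for i
    unfolding x_def by (rule ext[OF smooth_on_subset[OF open_UNIV _ _ lin]]) auto
  have dual: "E i p (x j) = i \<bullet> j" for i j
  proof -
    \<comment> \<open>The derivative of \<psi> drops out since it is multiplied by a coordinate
      vanishing at \<open>c p\<close>.\<close>
    have "((\<lambda>y. \<psi> y * ((y - c p) \<bullet> j)) has_derivative (\<lambda>v. v \<bullet> j)) (at (c p))"
    proof (rule has_derivative_eq_rhs)
      show "((\<lambda>y. \<psi> y * ((y - c p) \<bullet> j)) has_derivative
         (\<lambda>v. \<psi> (c p) * (v \<bullet> j) + frechet_derivative \<psi> (at (c p)) v * ((c p - c p) \<bullet> j))) (at (c p))"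
        by (rule has_derivative_mult[OF smooth_on_has_derivative[OF open_UNIV \<psi>(1) UNIV_I]])
          (auto intro!: derivative_eq_intros)
    qed (simp add: \<psi>(2))
    then have "((x j \<circ> inv_into U c) has_derivative (\<lambda>v. v \<bullet> j)) (at (c p))"
      by (rule has_derivative_transform_within_open[OF _ chart(2)[OF c] cp])
        (simp add: x_def chart_inv[OF c])
    then have "frechet_derivative (x j \<circ> inv_into U c) (at (c p)) = (\<lambda>v. v \<bullet> j)"
      using frechet_derivative_at by metis
    then show ?thesis using x p \<psi>(2) by (simp add: E_def coord_field_def)
  qed
  have inj: "inj_on (\<lambda>i. E i p) Basis"
  proof (rule inj_onI)
    fix i j :: 'b assume ij: "i \<in> Basis" "j \<in> Basis" and eq: "E i p = E j p"
    have "j \<bullet> i = i \<bullet> i" by (simp only: dual[symmetric] eq)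
    then show "i = j" using ij by (simp add: inner_Basis split: if_splits)
  qed
  have scalars_0: "a v = 0"
    if s: "(\<Sum>w\<in>(\<lambda>i. E i p) ` Basis. a w *\<^sub>t w) = 0" and v: "v \<in> (\<lambda>i. E i p) ` Basis"
    for a :: "'a tvec \<Rightarrow> real" and v
  proof -
    from v obtain j where j: "j \<in> Basis" "v = E j p" by blast
    have "0 = (\<Sum>i\<in>Basis. a (E i p) *\<^sub>t E i p) (x j)"
      using s by (simp add: sum.reindex[OF inj])
    also have "\<dots> = (\<Sum>i\<in>Basis. a (E i p) * (i \<bullet> j))"
      by (simp add: sum_fun_apply dual)
    also have "\<dots> = (\<Sum>i\<in>Basis. if i = j then a (E i p) else 0)"
      using j(1) by (intro sum.cong refl) (auto simp: inner_Basis)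
    also have "\<dots> = a v" using j by simp
    finally show ?thesis by simp
  qed
  have "tvec.independent ((\<lambda>i. E i p) ` Basis)"
    unfolding tvec.dependent_finite[OF finite_imageI[OF finite_Basis]] using scalars_0 by blast
  moreover have "tvec.span ((\<lambda>i. E i p) ` Basis) = tangent_space A p"
  proof
    show "tvec.span ((\<lambda>i. E i p) ` Basis) \<subseteq> tangent_space A p"
      by (rule tvec.span_minimal[OF _ tangent_space_subspace]) (use vfieldsD(1)[OF E] in auto)
    show "tangent_space A p \<subseteq> tvec.span ((\<lambda>i. E i p) ` Basis)"
    proof
      fix v assume v: "v \<in> tangent_space A p"
      have "v f = (\<Sum>i\<in>Basis. v (x i) *\<^sub>t E i p) f" for f
      proof (cases "f \<in> smooth_fun A")
        case False
        then show ?thesis by (simp add: sum_fun_apply tangentD(1)[OF v] E_def coord_field_def)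
      next
        case f: True
        let ?F = "f \<circ> inv_into U c"
        have "smooth_on ?F (ball (c p) r)"
          by (rule smooth_on_subset[OF chart(2)[OF c] _ r(2) smooth_funD[OF f c]]) simp
        then obtain G where G: "\<And>i. smooth_on (G i) (ball (c p) r)"
            "\<And>i. G i (c p) = frechet_derivative ?F (at (c p)) i"
            "\<And>y. y \<in> ball (c p) r \<Longrightarrow> ?F y = ?F (c p) + (\<Sum>i\<in>Basis. ((y - c p) \<bullet> i) * G i y)"
          by (rule hadamard) blast
        \<comment> \<open>The cut-off itself as a global function; the trivial factor 1 fits the
          form of \<open>ext\<close>. Its square is used below because \<open>x i\<close> and
          \<gamma> each absorb one copy.\<close>
        define e where "e = (\<lambda>q. if q \<in> U then \<psi> (c q) * 1 else 0)"
        define \<gamma> where "\<gamma> i = (\<lambda>q. if q \<in> U then \<psi> (c q) * G i (c q) else 0)" for i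
        have e: "e \<in> smooth_fun A" unfolding e_def by (rule ext) (simp add: smooth_on_const)
        have \<gamma>: "\<gamma> i \<in> smooth_fun A" for i unfolding \<gamma>_def by (rule ext) (rule G(1))
        have "(e * e) * (f - (\<lambda>_. f p)) = (\<Sum>i\<in>Basis. x i * \<gamma> i)"
        proof
          fix q
          show "((e * e) * (f - (\<lambda>_. f p))) q = (\<Sum>i\<in>Basis. x i * \<gamma> i) q"
          proof (cases "q \<in> U \<and> c q \<in> K")
            case True
            then have "c q \<in> ball (c p) r" using K by blast
            then have "f q = f p + (\<Sum>i\<in>Basis. ((c q - c p) \<bullet> i) * G i (c q))"
              using G(3)[of "c q"] chart_inv(1)[OF c p] chart_inv(1)[OF c, of q] True by simp
            then show ?thesis
              using True by (simp add: e_def x_def \<gamma>_def sum_fun_apply sum_distrib_left mult_ac)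
          next
            case False
            then show ?thesis
              using \<psi>(3) by (auto simp: e_def x_def \<gamma>_def sum_fun_apply)
          qed
        qed
        \<comment> \<open>By the product rule: \<open>f - (\<lambda>_. f p)\<close> vanishes at
          \<open>p\<close>, and \<open>e p = 1\<close>.\<close>
        moreover have "v ((e * e) * (f - (\<lambda>_. f p))) = v f"
          using f e p \<psi>(2) by (simp add: tangentD(4)[OF v] tangent_diff[OF v] tangent_const[OF v] e_def)
        \<comment> \<open>Here \<open>x i\<close> vanishes at \<open>p\<close>, so of each product
          only the derivative of \<open>x i\<close> survives.\<close>
        moreover have "v (\<Sum>i\<in>Basis. x i * \<gamma> i) = (\<Sum>i\<in>Basis. v (x i) * G i (c p))"
          using p \<psi>(2) by (simp add: tangent_sum(2)[OF v] x \<gamma> tangentD(4)[OF v])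
            (simp add: x_def \<gamma>_def mult.commute)
        ultimately have "v f = (\<Sum>i\<in>Basis. v (x i) * G i (c p))" by simp
        also have "\<dots> = (\<Sum>i\<in>Basis. v (x i) *\<^sub>t E i p) f"
          using f p \<psi>(2) by (simp add: sum_fun_apply G(2) E_def coord_field_def)
        finally show ?thesis .
      qed
      then have "v = (\<Sum>i\<in>Basis. v (x i) *\<^sub>t E i p)" ..
      also have "\<dots> \<in> tvec.span ((\<lambda>i. E i p) ` Basis)"
        by (intro tvec.span_sum tvec.span_scale tvec.span_base) simp
      finally show "v \<in> tvec.span ((\<lambda>i. E i p) ` Basis)" .
    qed
  qed
  ultimately show thesis using that[OF E inj] by blast
qed

text \<open>The values at \<open>p\<close> of global fields form a subspace containing the frame,
  hence the whole tangent space; so the choice in \<open>extend_vec\<close> is of an existing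
  object.\<close>

lemma extend_vec:
  assumes "v \<in> tangent_space A p"
  shows "extend_vec A p v \<in> vfields A" "extend_vec A p v p = v"
proof -
  obtain E :: "'b \<Rightarrow> 'a vfield" where E: "\<And>i. E i \<in> vfields A"
    "tvec.span ((\<lambda>i. E i p) ` Basis) = tangent_space A p" using tangent_space_frame[of p] by metis
  have "tvec.subspace ((\<lambda>X. X p) ` vfields A)"
  proof (rule tvec.subspaceI)
    show "0 \<in> (\<lambda>X. X p) ` vfields A" by (rule image_eqI[of _ _ 0]) simp_all
    show "u + v \<in> (\<lambda>X. X p) ` vfields A" if uv: "u \<in> (\<lambda>X. X p) ` vfields A" "v \<in> (\<lambda>X. X p) ` vfields A" for u v
    proof -
      obtain X Y where "X \<in> vfields A" "Y \<in> vfields A" "u = X p" "v = Y p" using uv by blast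
      then show ?thesis by (intro image_eqI[of _ _ "X + Y"]) simp_all
    qed
    show "a *\<^sub>t v \<in> (\<lambda>X. X p) ` vfields A" if v: "v \<in> (\<lambda>X. X p) ` vfields A" for a v
    proof -
      obtain X where "X \<in> vfields A" "v = X p" using v by blast
      then show ?thesis
        by (intro image_eqI[of _ _ "(\<lambda>_. a) \<odot> X"] vfields_fscale smooth_fun_const) (simp_all add: fscale_def)
    qed
  qed
  then have "tangent_space A p \<subseteq> (\<lambda>X. X p) ` vfields A"
    unfolding E(2)[symmetric] by (rule tvec.span_minimal[rotated]) (use E(1) in auto)
  then have "\<exists>X. X \<in> vfields A \<and> X p = v" using assms by blast
  then have "extend_vec A p v \<in> vfields A \<and> extend_vec A p v p = v"
    unfolding extend_vec_def by (rule someI_ex)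
  then show "extend_vec A p v \<in> vfields A" "extend_vec A p v p = v" by auto
qed

text \<open>The very choice made inside \<open>lin_trace\<close>, named so that traces unfold to
  sums over it.\<close>

definition tangent_basis :: "'a \<Rightarrow> 'a tvec set" where
  "tangent_basis p = (SOME B. tvec.independent B \<and> tvec.span B = tangent_space A p)"

lemma tangent_basis:
  shows "tvec.independent (tangent_basis p)" "tvec.span (tangent_basis p) = tangent_space A p"
    and "finite (tangent_basis p)" "card (tangent_basis p) = DIM('b)"
proof -
  obtain E :: "'b \<Rightarrow> 'a vfield" where E: "inj_on (\<lambda>i. E i p) Basis"
    "tvec.independent ((\<lambda>i. E i p) ` Basis)" "tvec.span ((\<lambda>i. E i p) ` Basis) = tangent_space A p"
    using tangent_space_frame[of p] by metis
  from E(2,3) have "\<exists>B. tvec.independent B \<and> tvec.span B = tangent_space A p" by blast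
  from someI_ex[OF this] show B: "tvec.independent (tangent_basis p)"
    "tvec.span (tangent_basis p) = tangent_space A p"
    unfolding tangent_basis_def by blast+
  obtain f where "bij_betw f ((\<lambda>i. E i p) ` Basis) (tangent_basis p)"
    using tvec.bij_if_span_eq_span_bases[OF E(2) B(1)] E(3) B(2) by blast
  then have "bij_betw (f \<circ> (\<lambda>i. E i p)) Basis (tangent_basis p)"
    using bij_betw_trans[OF inj_on_imp_bij_betw[OF E(1)]] by blast
  then show "finite (tangent_basis p)" "card (tangent_basis p) = DIM('b)"
    using bij_betw_finite bij_betw_same_card by (metis finite_Basis)+
qed

lemma tangent_basis_in: "b \<in> tangent_basis p \<Longrightarrow> b \<in> tangent_space A p"
  using tvec.span_base tangent_basis(2) by blast

section \<open>Traces\<close>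

lemma lin_trace_eq:
  "lin_trace (tangent_space A p) L =
    (\<Sum>b\<in>tangent_basis p. tvec.representation (tangent_basis p) (L b) b)"
  by (simp add: lin_trace_def tangent_basis_def Let_def)

lemma lin_trace_cong:
  "(\<And>v. v \<in> tangent_space A p \<Longrightarrow> L v = M v) \<Longrightarrow>
    lin_trace (tangent_space A p) L = lin_trace (tangent_space A p) M"
  unfolding lin_trace_eq by (intro sum.cong refl) (simp add: tangent_basis_in)

lemma lin_trace_add:
  assumes "\<And>v. v \<in> tangent_space A p \<Longrightarrow> L v \<in> tangent_space A p"
    and "\<And>v. v \<in> tangent_space A p \<Longrightarrow> M v \<in> tangent_space A p"
  shows "lin_trace (tangent_space A p) (\<lambda>v. L v + M v) =
    lin_trace (tangent_space A p) L + lin_trace (tangent_space A p) M"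
  unfolding lin_trace_eq sum.distrib[symmetric]
  by (intro sum.cong refl)
    (simp add: tvec.representation_add[OF tangent_basis(1)] tangent_basis(2) assms tangent_basis_in)

lemma lin_trace_scale:
  assumes "\<And>v. v \<in> tangent_space A p \<Longrightarrow> L v \<in> tangent_space A p"
  shows "lin_trace (tangent_space A p) (\<lambda>v. a *\<^sub>t L v) = a * lin_trace (tangent_space A p) L"
  unfolding lin_trace_eq sum_distrib_left
  by (intro sum.cong refl)
    (simp add: tvec.representation_scale[OF tangent_basis(1)] tangent_basis(2) assms tangent_basis_in)

lemma lin_trace_id: "lin_trace (tangent_space A p) (\<lambda>v. v) = DIM('b)"
proof -
  have "lin_trace (tangent_space A p) (\<lambda>v. v) = (\<Sum>b\<in>tangent_basis p. 1)"
    unfolding lin_trace_eq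
    by (intro sum.cong refl) (simp add: tvec.representation_basis[OF tangent_basis(1)])
  then show ?thesis by (simp add: tangent_basis(4))
qed

text \<open>The diagonal coefficient at \<open>b\<close> is \<open>\<theta> b\<close> times the
  coordinate of \<open>w\<close> at \<open>b\<close>; linearity reassembles the sum to
  \<open>w\<close>.\<close>

lemma lin_trace_rank_one:
  assumes w: "w \<in> tangent_space A p"
    and add: "\<And>u v. u \<in> tangent_space A p \<Longrightarrow> v \<in> tangent_space A p \<Longrightarrow> \<theta> (u + v) = \<theta> u + \<theta> v"
    and scale: "\<And>a v. v \<in> tangent_space A p \<Longrightarrow> \<theta> (a *\<^sub>t v) = a * \<theta> v"
  shows "lin_trace (tangent_space A p) (\<lambda>v. \<theta> v *\<^sub>t w) = \<theta> w"
proof -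
  let ?B = "tangent_basis p" and ?r = "tvec.representation (tangent_basis p) w"
  have "\<theta> 0 = 0" using scale[of 0 0] by simp
  \<comment> \<open>\<theta> is linear on the tangent space only, so membership of the partial sums
    is carried through the induction.\<close>
  then have sum: "(\<Sum>b\<in>I. ?r b *\<^sub>t b) \<in> tangent_space A p \<and> \<theta> (\<Sum>b\<in>I. ?r b *\<^sub>t b) = (\<Sum>b\<in>I. ?r b * \<theta> b)"
    if "I \<subseteq> ?B" for I
    using that
    by (induction I rule: infinite_finite_induct) (auto simp: add scale tangent_basis_in)
  have "lin_trace (tangent_space A p) (\<lambda>v. \<theta> v *\<^sub>t w) = (\<Sum>b\<in>?B. ?r b * \<theta> b)"
    unfolding lin_trace_eq
    by (intro sum.cong refl) (simp add: tvec.representation_scale[OF tangent_basis(1)] tangent_basis(2) w)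
  also have "\<dots> = \<theta> (\<Sum>b\<in>?B. ?r b *\<^sub>t b)" using sum[of ?B] by simp
  also have "(\<Sum>b\<in>?B. ?r b *\<^sub>t b) = w"
    by (rule tvec.sum_representation_eq[OF tangent_basis(1) _ tangent_basis(3)]) (simp_all add: tangent_basis(2) w)
  finally show ?thesis .
qed

end

section \<open>Almost contact metric manifolds\<close>

lemma fscale_apply: "(f \<odot> X) p = f p *\<^sub>t X p"
  by (simp add: fscale_def)

lemma fscale_0 [simp]: "0 \<odot> X = 0" "f \<odot> 0 = 0"
  and fscale_1 [simp]: "1 \<odot> X = X"
  by (simp_all add: fscale_def fun_eq_iff)

locale almost_contact_metric_manifold =
  fixes A :: "('a::{t2_space, second_countable_topology}, 'b::euclidean_space) atlas"
    and \<phi> :: "'a endo" and \<xi> :: "'a vfield" and \<eta> :: "'a oneform" and g :: "'a bilin"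
  assumes acm: "almost_contact_metric A \<phi> \<xi> \<eta> g"
begin

sublocale smooth_manifold A
  using acm by unfold_locales (simp add: almost_contact_metric_def)

lemma \<xi> [simp]: "\<xi> \<in> vfields A"
  and endo: "endo_tensor A \<phi>" and one_form: "one_form A \<eta>" and metric: "riemannian_metric A g"
  using acm by (simp_all add: almost_contact_metric_def)

lemma \<phi>_vfield [simp]: "X \<in> vfields A \<Longrightarrow> ap1 \<phi> X \<in> vfields A"
  using endo by (simp add: endo_tensor_def)

lemma \<eta>_smooth [simp]: "X \<in> vfields A \<Longrightarrow> ap1 \<eta> X \<in> smooth_fun A"
  using one_form by (simp add: one_form_def)

lemma g_smooth [simp]: "X \<in> vfields A \<Longrightarrow> Y \<in> vfields A \<Longrightarrow> ap2 g X Y \<in> smooth_fun A"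
  using metric by (simp add: riemannian_metric_def)

lemma g_sym: "X \<in> vfields A \<Longrightarrow> Y \<in> vfields A \<Longrightarrow> ap2 g X Y = ap2 g Y X"
  using metric vfieldsD(1) by (auto simp: riemannian_metric_def ap2_def fun_eq_iff)

lemma g_add_left:
  "X \<in> vfields A \<Longrightarrow> Y \<in> vfields A \<Longrightarrow> Z \<in> vfields A \<Longrightarrow> ap2 g (X + Y) Z = ap2 g X Z + ap2 g Y Z"
  using metric vfieldsD(1) by (auto simp: riemannian_metric_def ap2_def fun_eq_iff)

lemma g_scale_left:
  "X \<in> vfields A \<Longrightarrow> Y \<in> vfields A \<Longrightarrow> ap2 g (f \<odot> X) Y = f * ap2 g X Y"
  using metric vfieldsD(1) by (auto simp: riemannian_metric_def ap2_def fun_eq_iff fscale_def)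

lemma g_diff_left:
  assumes "X \<in> vfields A" "Y \<in> vfields A" "Z \<in> vfields A"
  shows "ap2 g (X - Y) Z = ap2 g X Z - ap2 g Y Z"
  using g_add_left[of "X - Y" Y Z] assms by simp

lemma g_0_left: "Z \<in> vfields A \<Longrightarrow> ap2 g 0 Z = 0"
  using g_diff_left[of 0 0 Z] by simp

lemmas g_left = g_add_left g_scale_left g_diff_left g_0_left

lemma g_right:
  assumes X: "X \<in> vfields A" and Y: "Y \<in> vfields A" and Z: "Z \<in> vfields A"
  shows "ap2 g Z (X + Y) = ap2 g Z X + ap2 g Z Y" "ap2 g Z (X - Y) = ap2 g Z X - ap2 g Z Y"
  by (subst (1 2 3) g_sym, simp_all add: g_left X Y Z)+

lemma g_uminus_right: "X \<in> vfields A \<Longrightarrow> Z \<in> vfields A \<Longrightarrow> ap2 g Z (- X) = - ap2 g Z X"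
  using g_right(2)[of 0 X Z] g_sym[of Z 0] by (simp add: g_0_left)

lemma g_scale_right:
  assumes "f \<in> smooth_fun A" "X \<in> vfields A" "Z \<in> vfields A"
  shows "ap2 g Z (f \<odot> X) = f * ap2 g Z X"
  using g_sym[of Z "f \<odot> X"] g_sym[of Z X] assms by (simp add: g_left)

lemma g_pos: "X \<in> vfields A \<Longrightarrow> X p \<noteq> 0 \<Longrightarrow> ap2 g X X p > 0"
  using metric vfieldsD(1) by (auto simp: riemannian_metric_def ap2_def)

lemma g_nondegenerate:
  assumes "X \<in> vfields A" "Y \<in> vfields A" "\<And>Z. Z \<in> vfields A \<Longrightarrow> ap2 g X Z = ap2 g Y Z"
  shows "X = Y"
proof
  fix p
  have "ap2 g (X - Y) (X - Y) p = 0"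
    using assms(1,2) assms(3)[of "X - Y"] by (simp add: g_left)
  then have "(X - Y) p = 0" using g_pos[of "X - Y" p] assms(1,2) by force
  then show "X p = Y p" by simp
qed

lemma g_\<xi>: "X \<in> vfields A \<Longrightarrow> ap2 g X \<xi> = ap1 \<eta> X"
  using acm by (simp add: almost_contact_metric_def)

lemma g_\<xi>_left: "X \<in> vfields A \<Longrightarrow> ap2 g \<xi> X = ap1 \<eta> X"
  using g_sym[of X \<xi>] g_\<xi> by simp

lemma \<eta>_\<xi>: "ap1 \<eta> \<xi> = 1"
  using acm by (simp add: almost_contact_metric_def)

lemma \<eta>_\<phi>: "X \<in> vfields A \<Longrightarrow> ap1 \<eta> (ap1 \<phi> X) = 0"
  using acm by (simp add: almost_contact_metric_def)

lemma \<phi>_\<xi>: "ap1 \<phi> \<xi> = 0"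
  using acm by (simp add: almost_contact_metric_def)

lemma \<phi>_\<phi>: "X \<in> vfields A \<Longrightarrow> ap1 \<phi> (ap1 \<phi> X) = - X + ap1 \<eta> X \<odot> \<xi>"
  using acm by (simp add: almost_contact_metric_def)

lemma g_\<phi>_\<phi>:
  "X \<in> vfields A \<Longrightarrow> Y \<in> vfields A \<Longrightarrow>
    ap2 g (ap1 \<phi> X) (ap1 \<phi> Y) = ap2 g X Y - ap1 \<eta> X * ap1 \<eta> Y"
  using acm by (simp add: almost_contact_metric_def)

lemma \<eta>_linear:
  assumes X: "X \<in> vfields A" and Y: "Y \<in> vfields A"
  shows "ap1 \<eta> (X + Y) = ap1 \<eta> X + ap1 \<eta> Y" "ap1 \<eta> (X - Y) = ap1 \<eta> X - ap1 \<eta> Y"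
    "f \<in> smooth_fun A \<Longrightarrow> ap1 \<eta> (f \<odot> X) = f * ap1 \<eta> X"
  using X Y by (simp_all add: g_\<xi>[symmetric] g_left)

text \<open>Compatibility applied to \<open>X\<close> and \<open>ap1 \<phi> Y\<close>, with the
  square of \<phi> expanded.\<close>

lemma g_\<phi>:
  assumes X: "X \<in> vfields A" and Y: "Y \<in> vfields A"
  shows "ap2 g (ap1 \<phi> X) Y = - ap2 g X (ap1 \<phi> Y)"
proof -
  have "ap1 \<phi> (ap1 \<phi> Y) = ap1 \<eta> Y \<odot> \<xi> - Y" using \<phi>_\<phi>[OF Y] by simp
  then have "ap2 g (ap1 \<phi> X) (ap1 \<eta> Y \<odot> \<xi> - Y) = ap2 g X (ap1 \<phi> Y)"
    using g_\<phi>_\<phi>[OF X \<phi>_vfield[OF Y]] Y by (simp add: \<eta>_\<phi>)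
  then have "- ap2 g (ap1 \<phi> X) Y = ap2 g X (ap1 \<phi> Y)"
    using X Y by (simp add: g_right g_scale_right g_\<xi> \<eta>_\<phi>)
  then show ?thesis by (metis minus_minus)
qed

lemma \<eta>_at_scale: "v \<in> tangent_space A p \<Longrightarrow> \<eta> p (c *\<^sub>t v) = c * \<eta> p v"
  and \<eta>_at_add: "u \<in> tangent_space A p \<Longrightarrow> v \<in> tangent_space A p \<Longrightarrow> \<eta> p (u + v) = \<eta> p u + \<eta> p v"
  using one_form by (simp_all add: one_form_def)

lemma \<eta>_at_diff:
  "u \<in> tangent_space A p \<Longrightarrow> v \<in> tangent_space A p \<Longrightarrow> \<eta> p (u - v) = \<eta> p u - \<eta> p v"
  using \<eta>_at_add[of "u - v" p v] by simp

lemma \<phi>_at: "v \<in> tangent_space A p \<Longrightarrow> \<phi> p v \<in> tangent_space A p"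
  using endo by (simp add: endo_tensor_def)

text \<open>Provides test directions at \<open>p\<close>. Applying \<phi> to an extension of a
  vector outside the line of \<xi> gives a field orthogonal to \<xi> everywhere; it is nonzero at
  \<open>p\<close> because \<phi> kills only multiples of \<xi>.\<close>

lemma horizontal_field:
  assumes "DIM('b) > 1"
  obtains Y where "Y \<in> vfields A" "ap1 \<eta> Y = 0" "Y p \<noteq> 0"
proof -
  have "\<not> tangent_basis p \<subseteq> tvec.span {\<xi> p}"
    using tvec.independent_span_bound[OF _ tangent_basis(1), of "{\<xi> p}" p] tangent_basis(4)[of p] assms
    by auto
  then obtain v where v: "v \<in> tangent_space A p" "v \<notin> tvec.span {\<xi> p}"
    using tangent_basis_in by blast
  let ?V = "extend_vec A p v"
  note V = extend_vec[OF v(1)]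
  have "ap1 \<phi> ?V p \<noteq> 0"
  proof
    assume 0: "ap1 \<phi> ?V p = 0"
    have "\<forall>c. \<forall>u\<in>tangent_space A p. \<phi> p (c *\<^sub>t u) = c *\<^sub>t \<phi> p u"
      using endo by (simp add: endo_tensor_def)
    from this[rule_format, of 0 0] have "\<phi> p 0 = 0" by simp
    then have "ap1 \<phi> (ap1 \<phi> ?V) p = 0" using 0 by (simp add: ap1_def)
    then have "v = ap1 \<eta> ?V p *\<^sub>t \<xi> p" using V by (simp add: \<phi>_\<phi> fscale_apply)
    then show False using v(2) tvec.span_scale[OF tvec.span_base, of "\<xi> p" "{\<xi> p}"] by (metis singletonI)
  qed
  then show thesis using V(1) by (intro that[of "ap1 \<phi> ?V"]) (simp_all add: \<eta>_\<phi>)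
qed

end

section \<open>Generalized symmetric metric connections\<close>

locale gen_sym_metric_manifold = almost_contact_metric_manifold A \<phi> \<xi> \<eta> g
  for A :: "('a::{t2_space, second_countable_topology}, 'b::euclidean_space) atlas"
    and \<phi> :: "'a endo" and \<xi> :: "'a vfield" and \<eta> :: "'a oneform" and g :: "'a bilin" +
  fixes \<alpha> \<beta> :: "'a \<Rightarrow> real" and D :: "'a conn"
  assumes kenmotsu: "kenmotsu A \<phi> \<xi> \<eta> g"
    and connection: "gen_sym_metric_connection A \<phi> \<eta> g \<alpha> \<beta> D"
begin

lemma \<alpha> [simp]: "\<alpha> \<in> smooth_fun A" and \<beta> [simp]: "\<beta> \<in> smooth_fun A"
  using connection by (simp_all add: gen_sym_metric_connection_def)

abbreviation "a \<equiv> \<alpha> + 1"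

lemma D_vfield [simp]: "X \<in> vfields A \<Longrightarrow> Y \<in> vfields A \<Longrightarrow> D X Y \<in> vfields A"
  and D_add: "X \<in> vfields A \<Longrightarrow> Y \<in> vfields A \<Longrightarrow> Z \<in> vfields A \<Longrightarrow> D X (Y + Z) = D X Y + D X Z"
  and D_scale: "f \<in> smooth_fun A \<Longrightarrow> X \<in> vfields A \<Longrightarrow> Y \<in> vfields A \<Longrightarrow>
        D X (f \<odot> Y) = deriv_along X f \<odot> Y + f \<odot> D X Y"
  and D_metric: "X \<in> vfields A \<Longrightarrow> Y \<in> vfields A \<Longrightarrow> Z \<in> vfields A \<Longrightarrow>
        deriv_along X (ap2 g Y Z) = ap2 g (D X Y) Z + ap2 g Y (D X Z)"
  and D_torsion: "X \<in> vfields A \<Longrightarrow> Y \<in> vfields A \<Longrightarrow> D X Y - D Y X - lie_bracket X Y =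
        \<alpha> \<odot> (ap1 \<eta> Y \<odot> X - ap1 \<eta> X \<odot> Y) + \<beta> \<odot> (ap1 \<eta> Y \<odot> ap1 \<phi> X - ap1 \<eta> X \<odot> ap1 \<phi> Y)"
  using connection
  by (simp_all add: gen_sym_metric_connection_def metric_connection_def linear_connection_def torsion_def)

lemma D_diff: "X \<in> vfields A \<Longrightarrow> Y \<in> vfields A \<Longrightarrow> Z \<in> vfields A \<Longrightarrow> D X (Y - Z) = D X Y - D X Z"
  using D_add[of X "Y - Z" Z] by simp

text \<open>The difference of \<open>D\<close> and the Levi-Civita connection is recovered from the torsion by the
  Koszul permutation trick.\<close>

lemma D_\<xi>:
  assumes X: "X \<in> vfields A"
  shows "D X \<xi> = a \<odot> (X - ap1 \<eta> X \<odot> \<xi>)"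
proof (rule g_nondegenerate)
  fix Z assume Z: "Z \<in> vfields A"
  obtain N where N: "levi_civita A g N" "\<forall>X\<in>vfields A. N X \<xi> = X - ap1 \<eta> X \<odot> \<xi>"
    using kenmotsu by (auto simp: kenmotsu_def)
  have NV: "N U V \<in> vfields A" if "U \<in> vfields A" "V \<in> vfields A" for U V
    using N(1) that by (simp add: levi_civita_def metric_connection_def linear_connection_def)
  have skew: "ap2 g (D U V) W p + ap2 g V (D U W) p = ap2 g (N U V) W p + ap2 g V (N U W) p"
    if "U \<in> vfields A" "V \<in> vfields A" "W \<in> vfields A" for U V W p
  proof -
    have "deriv_along U (ap2 g V W) = ap2 g (N U V) W + ap2 g V (N U W)"
      using N(1) that by (simp add: levi_civita_def metric_connection_def)
    then have "(ap2 g (D U V) W + ap2 g V (D U W)) p = (ap2 g (N U V) W + ap2 g V (N U W)) p"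
      using D_metric[OF that] by simp
    then show ?thesis by simp
  qed
  have tors: "ap2 g (D U V) W p - ap2 g (D V U) W p - (ap2 g (N U V) W p - ap2 g (N V U) W p) =
      \<alpha> p * (ap1 \<eta> V p * ap2 g U W p - ap1 \<eta> U p * ap2 g V W p) +
      \<beta> p * (ap1 \<eta> V p * ap2 g (ap1 \<phi> U) W p - ap1 \<eta> U p * ap2 g (ap1 \<phi> V) W p)"
    if U: "U \<in> vfields A" and V: "V \<in> vfields A" and W: "W \<in> vfields A" for U V W p
  proof -
    have "N U V - N V U - lie_bracket U V = 0"
      using N(1) that by (simp add: levi_civita_def torsion_def)
    then have lie: "lie_bracket U V = N U V - N V U" by simp
    have "ap2 g (D U V - D V U - (N U V - N V U)) W p = ap2 g (\<alpha> \<odot> (ap1 \<eta> V \<odot> U - ap1 \<eta> U \<odot> V)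
        + \<beta> \<odot> (ap1 \<eta> V \<odot> ap1 \<phi> U - ap1 \<eta> U \<odot> ap1 \<phi> V)) W p"
      using D_torsion[OF U V] lie by simp
    then show ?thesis using U V W by (simp add: g_left NV)
  qed
  show "ap2 g (D X \<xi>) Z = ap2 g (a \<odot> (X - ap1 \<eta> X \<odot> \<xi>)) Z"
  proof
    fix p
    have N\<xi>: "ap2 g (N X \<xi>) Z p = ap2 g X Z p - ap1 \<eta> X p * ap1 \<eta> Z p"
      using N(2) X Z by (simp add: g_left g_\<xi>_left)
    have sym: "ap2 g U V p = ap2 g V U p" if "U \<in> vfields A" "V \<in> vfields A" for U V
      using g_sym[OF that] by simp
    have \<phi>: "ap2 g (ap1 \<phi> Z) X p = - ap2 g (ap1 \<phi> X) Z p"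
      using g_\<phi>[OF X Z] g_sym[of X "ap1 \<phi> Z"] X Z by simp
    \<comment> \<open>Write C(U,V,W) = g(D_U V - N_U V, W), which is skew in V and W, and T(U,V,W) =
      C(U,V,W) - C(V,U,W). Then 2 C(X,\<xi>,Z) = T(X,\<xi>,Z) - T(\<xi>,Z,X) + T(Z,X,\<xi>). The
      \<beta>-terms cancel since \<phi> is skew.\<close>
    note facts = skew[OF X \<xi> Z, of p] skew[OF \<xi> X Z, of p] skew[OF Z X \<xi>, of p]
      tors[OF X \<xi> Z, of p] tors[OF Z X \<xi>, of p] tors[OF \<xi> Z X, of p]
    have "2 * ap2 g (D X \<xi>) Z p = 2 * (a p * (ap2 g X Z p - ap1 \<eta> X p * ap1 \<eta> Z p))"
      using facts N\<xi> \<phi> sym[OF \<xi> D_vfield[OF X Z]] sym[OF X D_vfield[OF \<xi> Z]] sym[OF X D_vfield[OF Z \<xi>]]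
        sym[OF \<xi> NV[OF X Z]] sym[OF X NV[OF \<xi> Z]] sym[OF X NV[OF Z \<xi>]] sym[OF X Z]
      by (simp add: g_\<xi> g_\<xi>_left \<eta>_\<xi> \<eta>_\<phi> \<phi>_\<xi> g_0_left X Z NV algebra_simps)
    then show "ap2 g (D X \<xi>) Z p = ap2 g (a \<odot> (X - ap1 \<eta> X \<odot> \<xi>)) Z p"
      using X Z by (simp add: g_left g_\<xi>_left)
  qed
qed (use X in simp_all)

text \<open>This says that \<eta> is closed: \<open>D X \<xi>\<close> contributes a term symmetric
  in both fields, and \<eta> annihilates the torsion.\<close>

lemma \<eta>_lie_bracket:
  assumes X: "X \<in> vfields A" and Y: "Y \<in> vfields A"
  shows "ap1 \<eta> (lie_bracket X Y) = deriv_along X (ap1 \<eta> Y) - deriv_along Y (ap1 \<eta> X)"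
proof -
  have d: "deriv_along U (ap1 \<eta> V) = ap1 \<eta> (D U V) + a * (ap2 g U V - ap1 \<eta> U * ap1 \<eta> V)"
    if "U \<in> vfields A" "V \<in> vfields A" for U V
    using D_metric[OF that \<xi>] that g_sym[OF that]
    by (simp add: g_\<xi> D_\<xi> g_right g_scale_right mult.commute)
  have "lie_bracket X Y = D X Y - D Y X - (\<alpha> \<odot> (ap1 \<eta> Y \<odot> X - ap1 \<eta> X \<odot> Y)
      + \<beta> \<odot> (ap1 \<eta> Y \<odot> ap1 \<phi> X - ap1 \<eta> X \<odot> ap1 \<phi> Y))"
    using D_torsion[OF X Y] by (simp add: algebra_simps)
  then have "ap1 \<eta> (lie_bracket X Y) = ap1 \<eta> (D X Y) - ap1 \<eta> (D Y X)"
    using X Y by (simp add: \<eta>_linear \<eta>_\<phi> mult.commute)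
  then show ?thesis using X Y g_sym[OF X Y] by (simp add: d mult.commute)
qed

text \<open>The torsion contributes the coefficient \<open>a * \<alpha>\<close> and the formula for
  \<open>D X \<xi>\<close> contributes \<open>- a * a\<close>; as \<open>a\<close> is \<alpha> + 1,
  they add up to \<open>- a\<close>. Derivatives of \<eta> cancel by closedness, those of
  \<open>a\<close> remain.\<close>

lemma curvature_\<xi>:
  assumes X: "X \<in> vfields A" and Y: "Y \<in> vfields A"
  shows "curvature D X Y \<xi> =
    deriv_along X a \<odot> (Y - ap1 \<eta> Y \<odot> \<xi>) - deriv_along Y a \<odot> (X - ap1 \<eta> X \<odot> \<xi>)
    - a \<odot> (ap1 \<eta> Y \<odot> X - ap1 \<eta> X \<odot> Y) + (a * \<beta>) \<odot> (ap1 \<eta> Y \<odot> ap1 \<phi> X - ap1 \<eta> X \<odot> ap1 \<phi> Y)"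
proof -
  have DD: "D U (a \<odot> (V - ap1 \<eta> V \<odot> \<xi>)) = deriv_along U a \<odot> (V - ap1 \<eta> V \<odot> \<xi>)
      + a \<odot> (D U V - (deriv_along U (ap1 \<eta> V) \<odot> \<xi> + ap1 \<eta> V \<odot> (a \<odot> (U - ap1 \<eta> U \<odot> \<xi>))))"
    if "U \<in> vfields A" "V \<in> vfields A" for U V
    using that by (simp add: D_\<xi> D_scale D_diff)
  show ?thesis
  proof (intro ext)
    fix p f
    have "(D X Y - D Y X - lie_bracket X Y) p f = (\<alpha> \<odot> (ap1 \<eta> Y \<odot> X - ap1 \<eta> X \<odot> Y)
        + \<beta> \<odot> (ap1 \<eta> Y \<odot> ap1 \<phi> X - ap1 \<eta> X \<odot> ap1 \<phi> Y)) p f"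
      using D_torsion[OF X Y] by simp
    then have lie: "lie_bracket X Y p f = D X Y p f - D Y X p f - (\<alpha> p * (ap1 \<eta> Y p * X p f - ap1 \<eta> X p * Y p f)
        + \<beta> p * (ap1 \<eta> Y p * ap1 \<phi> X p f - ap1 \<eta> X p * ap1 \<phi> Y p f))"
      by (simp add: fscale_apply)
    show "curvature D X Y \<xi> p f = (deriv_along X a \<odot> (Y - ap1 \<eta> Y \<odot> \<xi>) - deriv_along Y a \<odot> (X - ap1 \<eta> X \<odot> \<xi>)
      - a \<odot> (ap1 \<eta> Y \<odot> X - ap1 \<eta> X \<odot> Y) + (a * \<beta>) \<odot> (ap1 \<eta> Y \<odot> ap1 \<phi> X - ap1 \<eta> X \<odot> ap1 \<phi> Y)) p f"
      using X Y
      by (simp add: curvature_def DD D_\<xi> \<eta>_lie_bracket fscale_apply lie) (simp add: algebra_simps)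
  qed
qed

lemma curvature_vfield [simp]:
  "X \<in> vfields A \<Longrightarrow> Y \<in> vfields A \<Longrightarrow> Z \<in> vfields A \<Longrightarrow> curvature D X Y Z \<in> vfields A"
  by (simp add: curvature_def)

text \<open>Metric compatibility differentiated twice; the mixed terms cancel on antisymmetrizing.
  It is used to reduce the \<xi>-component of curvature on other fields to the explicitly known
  curvature on \<xi>.\<close>

lemma curvature_skew:
  assumes X: "X \<in> vfields A" and Y: "Y \<in> vfields A" and Z: "Z \<in> vfields A" and V: "V \<in> vfields A"
  shows "ap2 g (curvature D X Y Z) V = - ap2 g Z (curvature D X Y V)"
proof -
  have 2: "deriv_along U (deriv_along W (ap2 g Z V)) =
      ap2 g (D U (D W Z)) V + ap2 g (D W Z) (D U V) + (ap2 g (D U Z) (D W V) + ap2 g Z (D U (D W V)))"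
    if "U \<in> vfields A" "W \<in> vfields A" for U W
    using that Z V by (simp add: D_metric deriv_along_add)
  have "ap2 g (D (lie_bracket X Y) Z) V + ap2 g Z (D (lie_bracket X Y) V) =
      deriv_along X (deriv_along Y (ap2 g Z V)) - deriv_along Y (deriv_along X (ap2 g Z V))"
    using D_metric[of "lie_bracket X Y" Z V] X Y Z V by (simp add: deriv_along_lie_bracket)
  then show ?thesis
    unfolding 2[OF X Y] 2[OF Y X] using X Y Z V
    by (simp add: curvature_def g_left g_right algebra_simps)
qed

text \<open>The endomorphism to be traced is a multiple of the identity, plus two rank-one maps,
  plus a multiple of \<phi>. The number \<open>t\<close> is the trace of \<phi> at \<open>p\<close>,
  the same for all \<open>Y\<close>.\<close>

lemma ricci_\<xi>:
  obtains t where "\<And>Y. Y \<in> vfields A \<Longrightarrow> ricci A D Y \<xi> p =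
    (2 - real DIM('b)) * Y p a - ap1 \<eta> Y p * \<xi> p a
    - (real DIM('b) - 1) * a p * ap1 \<eta> Y p + a p * \<beta> p * ap1 \<eta> Y p * t"
proof
  let ?T = "tangent_space A p"
  fix Y assume Y: "Y \<in> vfields A"
  define w1 where "w1 = Y p - ap1 \<eta> Y p *\<^sub>t \<xi> p"
  define w2 where "w2 = Y p a *\<^sub>t \<xi> p + a p *\<^sub>t Y p - (a p * \<beta> p) *\<^sub>t \<phi> p (Y p)"
  have w: "w1 \<in> ?T" "w2 \<in> ?T" by (simp_all add: w1_def w2_def vfieldsD(1) Y \<phi>_at)
  \<comment> \<open>By \<open>curvature_\<xi>\<close> the value at \<open>p\<close> depends on the
    chosen extension only through \<open>v\<close>, its derivative term being
    \<open>v a\<close>.\<close>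
  have tr: "ricci A D Y \<xi> p = lin_trace ?T (\<lambda>v. (- (Y p a + a p * ap1 \<eta> Y p)) *\<^sub>t v
      + (v a *\<^sub>t w1 + (\<eta> p v *\<^sub>t w2 + (a p * \<beta> p * ap1 \<eta> Y p) *\<^sub>t \<phi> p v)))"
    unfolding ricci_def
  proof (rule lin_trace_cong)
    fix v assume v: "v \<in> ?T"
    note V = extend_vec[OF v]
    show "curvature D (extend_vec A p v) Y \<xi> p = (- (Y p a + a p * ap1 \<eta> Y p)) *\<^sub>t v
      + (v a *\<^sub>t w1 + (\<eta> p v *\<^sub>t w2 + (a p * \<beta> p * ap1 \<eta> Y p) *\<^sub>t \<phi> p v))"
      using V(2)
      by (intro ext) (simp add: curvature_\<xi>[OF V(1) Y] fscale_apply deriv_along_def ap1_def w1_def w2_def,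
          simp add: algebra_simps)
  qed
  have "\<eta> p w2 = Y p a + a p * ap1 \<eta> Y p"
  proof -
    have "\<eta> p w2 = Y p a * ap1 \<eta> \<xi> p + a p * ap1 \<eta> Y p - a p * \<beta> p * ap1 \<eta> (ap1 \<phi> Y) p"
      by (simp add: w2_def \<eta>_at_scale \<eta>_at_add \<eta>_at_diff vfieldsD(1) Y \<phi>_at ap1_def)
    then show ?thesis using Y by (simp add: \<eta>_\<xi> \<eta>_\<phi>)
  qed
  moreover have "lin_trace ?T (\<lambda>v. v a *\<^sub>t w1) = w1 a" by (rule lin_trace_rank_one[OF w(1)]) simp_all
  moreover have "lin_trace ?T (\<lambda>v. \<eta> p v *\<^sub>t w2) = \<eta> p w2"
    by (rule lin_trace_rank_one[OF w(2)]) (simp_all add: \<eta>_at_scale \<eta>_at_add)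
  moreover have "lin_trace ?T (\<lambda>v. (- (Y p a + a p * ap1 \<eta> Y p)) *\<^sub>t v) = - (Y p a + a p * ap1 \<eta> Y p) * real DIM('b)"
    by (simp only: lin_trace_scale[of p "\<lambda>v. v"] lin_trace_id)
  moreover have "lin_trace ?T (\<lambda>v. (a p * \<beta> p * ap1 \<eta> Y p) *\<^sub>t \<phi> p v) = a p * \<beta> p * ap1 \<eta> Y p * lin_trace ?T (\<phi> p)"
    by (rule lin_trace_scale) (rule \<phi>_at)
  ultimately have "ricci A D Y \<xi> p = - (Y p a + a p * ap1 \<eta> Y p) * real DIM('b)
      + (w1 a + ((Y p a + a p * ap1 \<eta> Y p) + a p * \<beta> p * ap1 \<eta> Y p * lin_trace ?T (\<phi> p)))"
    unfolding tr by (simp add: lin_trace_add w \<phi>_at)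
  then show "ricci A D Y \<xi> p = (2 - real DIM('b)) * Y p a - ap1 \<eta> Y p * \<xi> p a
    - (real DIM('b) - 1) * a p * ap1 \<eta> Y p + a p * \<beta> p * ap1 \<eta> Y p * lin_trace ?T (\<phi> p)"
    by (simp add: w1_def) (simp add: algebra_simps)
qed

end

section \<open>Ricci solitons\<close>

locale ricci_soliton_manifold = gen_sym_metric_manifold A \<phi> \<xi> \<eta> g \<alpha> \<beta> D
  for A :: "('a::{t2_space, second_countable_topology}, 'b::euclidean_space) atlas"
    and \<phi> :: "'a endo" and \<xi> :: "'a vfield" and \<eta> :: "'a oneform" and g :: "'a bilin"
    and \<alpha> \<beta> :: "'a \<Rightarrow> real" and D :: "'a conn" +
  fixes lam :: real
  assumes soliton: "ricci_soliton A g \<eta> D \<xi> lam"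
begin

lemma ricci:
  assumes X: "X \<in> vfields A" and Y: "Y \<in> vfields A"
  shows "ricci A D X Y = a * ap1 \<eta> X * ap1 \<eta> Y - (a + (\<lambda>_. lam)) * ap2 g X Y"
proof
  fix p
  have "2 * ricci A D X Y p = - ap2 g (D X \<xi>) Y p - ap2 g X (D Y \<xi>) p - 2 * lam * ap2 g X Y p"
    using soliton X Y by (simp add: ricci_soliton_def eta_ricci_soliton_def)
  also have "\<dots> = 2 * (a * ap1 \<eta> X * ap1 \<eta> Y - (a + (\<lambda>_. lam)) * ap2 g X Y) p"
    using X Y by (simp add: D_\<xi> g_left g_right g_scale_right g_\<xi> g_\<xi>_left algebra_simps)
  finally show "ricci A D X Y p = (a * ap1 \<eta> X * ap1 \<eta> Y - (a + (\<lambda>_. lam)) * ap2 g X Y) p" by simp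
qed

lemma ricci_op:
  assumes X: "X \<in> vfields A"
  shows "ricci_op A g D X = (a * ap1 \<eta> X) \<odot> \<xi> - (a + (\<lambda>_. lam)) \<odot> X"
  unfolding ricci_op_def
proof (rule the_equality)
  show Q: "(a * ap1 \<eta> X) \<odot> \<xi> - (a + (\<lambda>_. lam)) \<odot> X \<in> vfields A \<and>
    (\<forall>Y\<in>vfields A. ap2 g ((a * ap1 \<eta> X) \<odot> \<xi> - (a + (\<lambda>_. lam)) \<odot> X) Y = ricci A D X Y)"
    using X by (simp add: ricci g_left g_\<xi>_left)
  show "W = (a * ap1 \<eta> X) \<odot> \<xi> - (a + (\<lambda>_. lam)) \<odot> X"
    if "W \<in> vfields A \<and> (\<forall>Y\<in>vfields A. ap2 g W Y = ricci A D X Y)" for W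
    using that Q by (intro g_nondegenerate) auto
qed

lemma ricci_op_vfield [simp]: "X \<in> vfields A \<Longrightarrow> ricci_op A g D X \<in> vfields A"
  by (simp add: ricci_op)

lemma W2_vfield [simp]:
  "X \<in> vfields A \<Longrightarrow> Y \<in> vfields A \<Longrightarrow> Z \<in> vfields A \<Longrightarrow> W2_curvature A g D X Y Z \<in> vfields A"
  by (simp add: W2_curvature_def)

lemma curvature_\<xi>_\<xi>:
  assumes Y: "Y \<in> vfields A" and "ap1 \<eta> Y = 0"
  shows "curvature D Y \<xi> \<xi> = (a * \<beta>) \<odot> ap1 \<phi> Y - (deriv_along \<xi> a + a) \<odot> Y"
  using assms by (intro ext) (simp add: curvature_\<xi> fscale_apply \<eta>_\<xi> \<phi>_\<xi> algebra_simps)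

text \<open>The condition \<open>S \<cdot> W\<^sub>2 = 0\<close> at \<open>(X, Y, \<xi>, \<xi>)\<close> with \<open>X\<close> and \<open>Y\<close> orthogonal to \<open>\<xi>\<close>, paired
  with \<open>\<xi>\<close>.\<close>

lemma S_dot_W2_horizontal:
  fixes p
  defines "k \<equiv> 1 / (real DIM('b) - 1)" and "s \<equiv> \<xi> p a + a p"
  assumes SW: "S_dot_W2_vanishes A g D \<xi>"
    and X: "X \<in> vfields A" "ap1 \<eta> X = 0" and Y: "Y \<in> vfields A" "ap1 \<eta> Y = 0"
  shows "(s * (2 * lam + a p) - k * ((lam + a p)\<^sup>2 + lam\<^sup>2)) * ap2 g X Y p
    = a p * \<beta> p * (2 * lam + a p) * ap2 g X (ap1 \<phi> Y) p"
proof -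
  let ?S = "ricci A D" and ?W = "W2_curvature A g D"
  \<comment> \<open>Curvature on a horizontal field is not known explicitly, but its \<xi>-component
    is, by skew-symmetry.\<close>
  have \<eta>R: "ap1 \<eta> (curvature D Y \<xi> X) = - ap2 g X (curvature D Y \<xi> \<xi>)"
    using curvature_skew[OF Y(1) \<xi> X(1) \<xi>] X(1) Y(1) by (simp add: g_\<xi>)
  \<comment> \<open>The term \<open>k * (lam + a p)\<close> comes from the Ricci operator on the
    horizontal field \<open>Y\<close>.\<close>
  have W1: "ap2 g X (?W Y \<xi> \<xi>) p = (k * (lam + a p) - s) * ap2 g X Y p + a p * \<beta> p * ap2 g X (ap1 \<phi> Y) p"
    using X Y
    by (simp add: W2_curvature_def curvature_\<xi>_\<xi> ricci_op g_right g_uminus_right g_scale_right g_\<xi> \<eta>_\<xi> vfieldsD)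
      (simp add: k_def s_def deriv_along_def algebra_simps)
  have \<eta>W1: "ap1 \<eta> (?W Y \<xi> \<xi>) p = 0"
    using X Y
    by (simp add: W2_curvature_def curvature_\<xi>_\<xi> ricci_op g_\<xi> \<eta>_\<xi> \<eta>_linear \<eta>_\<phi> vfieldsD)
  have \<eta>W2: "ap1 \<eta> (?W Y X \<xi>) p = 0"
    using X Y
    by (simp add: W2_curvature_def curvature_\<xi> ricci_op g_\<xi> \<eta>_\<xi> \<eta>_linear \<eta>_\<phi> vfieldsD)
  \<comment> \<open>Here the Ricci operator acts on \<xi> instead, where its value is
    \<open>- lam\<close>.\<close>
  have \<eta>W3: "ap1 \<eta> (?W Y \<xi> X) p = (s - k * lam) * ap2 g X Y p - a p * \<beta> p * ap2 g X (ap1 \<phi> Y) p"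
    using X Y g_sym[OF X(1) Y(1)]
    by (simp add: W2_curvature_def \<eta>R curvature_\<xi>_\<xi> ricci_op g_right g_uminus_right g_scale_right g_\<xi> g_\<xi>_left \<eta>_\<xi> \<eta>_linear
        vfieldsD) (simp add: k_def s_def deriv_along_def algebra_simps)
  have "?S X (?W Y \<xi> \<xi>) \<odot> \<xi> - ?S \<xi> (?W Y \<xi> \<xi>) \<odot> X + ?S X Y \<odot> ?W \<xi> \<xi> \<xi> - ?S \<xi> Y \<odot> ?W X \<xi> \<xi>
      + ?S X \<xi> \<odot> ?W Y \<xi> \<xi> - ?S \<xi> \<xi> \<odot> ?W Y X \<xi> + ?S X \<xi> \<odot> ?W Y \<xi> \<xi> - ?S \<xi> \<xi> \<odot> ?W Y \<xi> X = 0"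
    using SW X(1) Y(1) by (simp add: S_dot_W2_vanishes_def Let_def)
  then have "ap2 g (?S X (?W Y \<xi> \<xi>) \<odot> \<xi> - ?S \<xi> (?W Y \<xi> \<xi>) \<odot> X + ?S X Y \<odot> ?W \<xi> \<xi> \<xi> - ?S \<xi> Y \<odot> ?W X \<xi> \<xi>
      + ?S X \<xi> \<odot> ?W Y \<xi> \<xi> - ?S \<xi> \<xi> \<odot> ?W Y X \<xi> + ?S X \<xi> \<odot> ?W Y \<xi> \<xi> - ?S \<xi> \<xi> \<odot> ?W Y \<xi> X) \<xi> p = 0"
    by (simp add: g_0_left)
  moreover have "?W \<xi> \<xi> \<xi> = 0"
    by (intro ext) (simp add: W2_curvature_def curvature_\<xi> fscale_apply)
  \<comment> \<open>The Ricci tensor of \<xi> with a horizontal field is 0, and that of \<xi> with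
    itself is \<open>- lam\<close>; together with the vanishing components this leaves two
    terms.\<close>
  ultimately have "- (a p + lam) * ap2 g X (?W Y \<xi> \<xi>) p + lam * ap1 \<eta> (?W Y \<xi> X) p = 0"
    using X Y \<eta>W1 \<eta>W2 by (simp add: ricci g_left g_\<xi> g_\<xi>_left \<eta>_\<xi> \<eta>_linear) (simp add: algebra_simps)
  then show ?thesis
    unfolding W1 \<eta>W3 by (simp add: algebra_simps power2_eq_square)
qed

lemma S_dot_W2_soliton_rigidity:
  assumes SW: "S_dot_W2_vanishes A g D \<xi>" and dim: "DIM('b) > 1"
  shows "lam = 0" "\<alpha> p = -1"
proof -
  define k where "k = 1 / (real DIM('b) - 1)"
  have k: "k > 0" using dim by (simp add: k_def)
  have a0: "a p * (lam + a p) = 0 \<and> \<xi> p a + a p = k * lam" for p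
  proof -
    obtain Y where Y: "Y \<in> vfields A" "ap1 \<eta> Y = 0" "Y p \<noteq> 0" using horizontal_field[OF dim] .
    have pos: "ap2 g Y Y p > 0" using g_pos Y by blast
    have orth: "ap2 g Y (ap1 \<phi> Y) p = 0"
      using g_\<phi>[OF Y(1) Y(1)] g_sym[OF Y(1) \<phi>_vfield[OF Y(1)]] by (simp add: fun_eq_iff)
    note H = S_dot_W2_horizontal[OF SW, folded k_def]
    \<comment> \<open>Testing with equal fields removes the right side, because \<open>Y\<close> is
      orthogonal to \<open>ap1 \<phi> Y\<close>.\<close>
    from H[OF Y(1,2) Y(1,2), of p] pos orth
    have 1: "(\<xi> p a + a p) * (2 * lam + a p) = k * ((lam + a p)\<^sup>2 + lam\<^sup>2)" by simp
    \<comment> \<open>Testing with \<open>ap1 \<phi> Y\<close> against \<open>Y\<close> removes the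
      left side, and the inner product on the right is the positive
      \<open>ap2 g Y Y p\<close>.\<close>
    from H[OF \<phi>_vfield[OF Y(1)] \<eta>_\<phi>[OF Y(1)] Y(1,2), of p] pos orth Y g_sym[OF Y(1) \<phi>_vfield[OF Y(1)]]
    have 2: "a p * \<beta> p * (2 * lam + a p) = 0" by (simp add: g_\<phi>_\<phi>)
    obtain t where "ricci A D \<xi> \<xi> p = (2 - real DIM('b)) * \<xi> p a - \<xi> p a - (real DIM('b) - 1) * a p + a p * \<beta> p * t"
      using ricci_\<xi>[of p] \<xi> \<eta>_\<xi> by (metis mult.right_neutral mult_1 one_fun_def)
    then have 3: "(real DIM('b) - 1) * (\<xi> p a + a p) = lam + a p * \<beta> p * t"
      by (simp add: ricci g_\<xi> \<eta>_\<xi> algebra_simps)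
    have 4: "a p * \<beta> p = 0"
    proof (rule ccontr)
      assume "a p * \<beta> p \<noteq> 0"
      then have "2 * lam + a p = 0" "a p \<noteq> 0" using 2 by auto
      then show False using 1 k by (auto simp: sum_power2_eq_zero_iff)
    qed
    then have 5: "\<xi> p a + a p = k * lam" using 3 dim by (simp add: k_def field_simps)
    then have "k * (lam * (2 * lam + a p)) = k * ((lam + a p)\<^sup>2 + lam\<^sup>2)" using 1 by (simp add: mult.assoc)
    then have "lam * (2 * lam + a p) = (lam + a p)\<^sup>2 + lam\<^sup>2" using k by simp
    then have "a p * (lam + a p) = 0" by (simp add: power2_eq_square algebra_simps)
    then show ?thesis using 5 by simp
  qed
  \<comment> \<open>Product rule for an arbitrary smooth \<open>h\<close>, to be instantiated with
    \<open>a\<close> as a single function.\<close>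
  have "\<xi> p (h * ((\<lambda>_. lam) + h)) = (lam + 2 * h p) * \<xi> p h" if "h \<in> smooth_fun A" for h
    using that
    by (simp add: tangentD(2,4)[OF vfieldsD(1)[OF \<xi>]] tangent_const[OF vfieldsD(1)[OF \<xi>]] algebra_simps)
  moreover have "a * ((\<lambda>_. lam) + a) = 0" using a0 by (simp add: fun_eq_iff)
  ultimately have "(lam + 2 * a p) * \<xi> p a = \<xi> p 0" by (metis \<alpha> smooth_fun_1 smooth_fun_add)
  then have "(lam + 2 * a p) * \<xi> p a = 0" by (simp only: tangent_0[OF vfieldsD(1)[OF \<xi>]])
  moreover have "\<xi> p a = k * lam - a p" using a0[of p] by simp
  ultimately have "(lam + 2 * a p) * (k * lam - a p) = 0" by simp
  \<comment> \<open>The branch may vary with \<open>p\<close>; no derivative is taken inside a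
    branch, since \<open>\<xi> p a\<close> has already been expressed through
    \<open>a p\<close>.\<close>
  moreover have "a p = 0 \<or> a p = - lam" using a0[of p] by auto
  ultimately have "lam = 0 \<and> a p = 0"
  proof (elim disjE)
    assume "(lam + 2 * a p) * (k * lam - a p) = 0" and a: "a p = 0"
    then have "lam * (k * lam) = 0" unfolding a by simp
    then show ?thesis using k a by simp
  next
    assume "(lam + 2 * a p) * (k * lam - a p) = 0" and a: "a p = - lam"
    then have "lam * ((k + 1) * lam) = 0" unfolding a by (simp add: algebra_simps)
    then show ?thesis using k a by simp
  qed
  then show "lam = 0" "\<alpha> p = -1" by (simp_all add: add_eq_0_iff)
qed

end

theorem corollary10p2:
  fixes A :: "('a::{t2_space, second_countable_topology}, 'b::euclidean_space) atlas"
    and \<phi> :: "'a endo" and \<xi> :: "'a vfield" and \<eta> :: "'a oneform" and g :: "'a bilin"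
    and \<alpha> \<beta> :: "'a \<Rightarrow> real" and D :: "'a conn" and lam :: real and n :: nat
  assumes "n \<ge> 1" and "DIM('b) = 2 * n + 1"
    and "kenmotsu A \<phi> \<xi> \<eta> g"
    and "gen_sym_metric_connection A \<phi> \<eta> g \<alpha> \<beta> D"
    and "S_dot_W2_vanishes A g D \<xi>"
    and "ricci_soliton A g \<eta> D \<xi> lam"
  shows "(\<forall>p. - (\<alpha> p + 1) * (2 * lam + \<alpha> p + 1)
              + ((lam + \<alpha> p + 1)\<^sup>2 + lam\<^sup>2) / (2 * real n) = 0 \<and>
            \<beta> p * (\<alpha> p + 1) * (2 * lam + \<alpha> p + 1) = 0) \<and>
         ((\<forall>p. \<alpha> p = - 1) \<or> (\<forall>p. \<alpha> p = - 2 * lam - 1)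
            \<longrightarrow> steady_ricci_soliton A g \<eta> D \<xi> lam)"
proof -
  interpret ricci_soliton_manifold A \<phi> \<xi> \<eta> g \<alpha> \<beta> D lam
    using assms(3,4,6) by unfold_locales (auto simp: kenmotsu_def)
  \<comment> \<open>After substituting these values every summand of (i) contains a vanishing
    factor; \<open>n \<ge> 1\<close> supplies the dimension bound.\<close>
  have "lam = 0" "\<And>p. \<alpha> p = -1" using S_dot_W2_soliton_rigidity[OF assms(5)] assms(1,2) by simp_all
  then show ?thesis using assms(6) by (simp add: steady_ricci_soliton_def)
qed

end
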